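(* Let $\mathcal M\hat C^{\perp}$ denote the orthogonal complement of $\mathcal M\hat C$ in $\mathbf W=\mathrm{Span}\{\hat C_i^{-},\hat C_i^{+}:0\le i\le d-1\}$. The $\tilde T$-module $\mathcal M\hat C^{\perp}$ is irreducible.
   Context: **Graph.** $\Gamma$ is a finite undirected connected graph without loops or multiple edges, with vertex set $X$, path-length distance $\partial$ and diameter $d\ge 3$; $\Gamma_i(y)=\{z\in X:\partial(y,z)=i\}$, $\Gamma(y)=\Gamma_1(y)$. $\Gamma$ is distance-regular: $p^h_{ij}=|\Gamma_i(y)\cap\Gamma_j(z)|$ depends only on $i,j$ and $h=\partial(y,z)$. Put $a_i=p^i_{1,i}$, $b_i=p^i_{1,i+1}$, $c_i=p^i_{1,i-1}$ ($b_d=c_0=0$), $k=b_0$. Complex matrices indexed by $X$ act on $\mathbf V=\mathbb C^X$ with inner product $\langle u,v\rangle=u^t\overline v$; $\hat y$ is the standard basis vector at $y$, $\hat Y=\sum_{y\in Y}\hat y$, $\mathbf j=\hat X$. $A_i$ is the $i$-th distance matrix, $A=A_1$, $\mathcal M$ is the algebra generated by $A$ (Bose–Mesner algebra), with primitive idempotents $E_0=|X|^{-1}J,E_1,\dots,E_d$ ($J$ all-ones) and $A=\sum_i\theta_iE_i$. $\Gamma$ is $Q$-polynomial with respect to $E_0,\dots,E_d$: writing $E_i\circ E_j=|X|^{-1}\sum_h q^h_{ij}E_h$ (entrywise product), $q^h_{ij}=0$ (resp. $\ne0$) if one of $h,i,j$ is greater than (resp. equal to) the sum of the other two. It is assumed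 that $\theta_0>\theta_1>\dots>\theta_d$. **Clique and Terwilliger algebras.** $C\subseteq X$ is a Delsarte clique: a nonempty set of mutually adjacent vertices with $|C|=1-k/\theta_d$. Fix $x\in C$. For $y\in X$, $A^*(y)$ is the diagonal matrix with $(z,z)$-entry $|X|(E_1)_{yz}$; $A^*=A^*(x)$. $E^*_i$ ($0\le i\le d$) is the diagonal projection onto $\mathrm{Span}\{\hat z:\partial(x,z)=i\}$, and $A^*=\sum_i\theta^*_iE^*_i$. For $0\le i\le d-1$, $C_i=\{y\in X:\partial(y,C)=i\}$ (these partition $X$), and $\tilde E^*_i$ is the diagonal projection onto $\mathrm{Span}\{\hat z:z\in C_i\}$. $\tilde A^*=|C|^{-1}\sum_{y\in C}A^*(y)$; $\tilde A^*=\sum_{i=0}^{d-1}\tilde\theta^*_i\tilde E^*_i$ with $\tilde\theta_i^*$ mutually distinct. $\tilde T$ is the algebra generated by $A,\tilde A^*$. A $\tilde T$-module is a subspace of $\mathbf V$ invariant under $\tilde T$. $C_i^-=C_i\cap\Gamma_i(x)$, $C_i^+=C_i\cap\Gamma_{i+1}(x)$ for $0\le i\le d-1$. $\mathbf W$ is a $\tilde T$-module containing the $\tilde T$-module $\mathcal M\hat C$. **Leonard systems.** On a complex vector space $V$ of dimension $n+1$, a Leonard system of diameter $n$ is a sequence $(B;B^*;\{F_i\}_{i=0}^n;\{F^*_i\}_{i=0}^n)$ where $B,B^*\in\mathrm{End}(V)$ each have $n+1$ distinct eigenvalues, $\{F_i\}$ (resp. $\{F_i^*\}$) is an ordering of the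 primitive idempotents (spectral projections) of $B$ (resp. $B^*$), and $F_iB^*F_j$, $F^*_iBF^*_j$ are $0$ if $|i-j|>1$ and nonzero if $|i-j|=1$. Eigenvalues $\vartheta_i$, dual eigenvalues $\vartheta^*_i$ are defined by $BF_i=\vartheta_iF_i$, $B^*F_i^*=\vartheta_i^*F_i^*$. The first split sequence is the sequence of nonzero scalars $\varphi_1,\dots,\varphi_n$ such that in some basis $B$ is lower bidiagonal with diagonal $\vartheta_0,\dots,\vartheta_n$ and subdiagonal entries $1$, and $B^*$ is upper bidiagonal with diagonal $\vartheta^*_0,\dots,\vartheta_n^*$ and superdiagonal $\varphi_1,\dots,\varphi_n$. The second split sequence $\{\phi_i\}$ is the first split sequence of $(B;B^*;\{F_{n-i}\};\{F^*_i\})$. The parameter array is $(\{\vartheta_i\},\{\vartheta_i^*\},\{\varphi_i\},\{\phi_i\})$. **$q$-Racah assumption.** $q\in\mathbb C$ is nonzero, $q^2\neq1$. $(A;A^*;\{E_i\}_{i=0}^d;\{E_i^*\}_{i=0}^d)$ acts on $\mathcal M\hat x$ (of dimension $d+1$) as a Leonard system $\Phi$ with parameter array $(\{\theta_i\},\{\theta^*_i\},\{\varphi_i\},\{\phi_i\})$. $\Gamma$ is assumed to have $q$-Racah type: there are nonzero $h,h^*,s,s^*,r_1,r_2\in\mathbb C$ (fixed) with $r_1r_2=ss^*q^{d+1}$, none of $q^i,r_1q^i,r_2q^i,s^*q^i/r_1,s^*q^i/r_2$ equal to $1$ for $1\le i\le d$, neither of $sq^i,s^*q^i$ equal to $1$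 for $2\le i\le 2d$, and $\theta_i=\theta_0+h(1-q^i)(1-sq^{i+1})q^{-i}$, $\theta^*_i=\theta^*_0+h^*(1-q^i)(1-s^*q^{i+1})q^{-i}$ ($0\le i\le d$), $\varphi_i=hh^*q^{1-2i}(1-q^i)(1-q^{i-d-1})(1-r_1q^i)(1-r_2q^i)$, $\phi_i=hh^*q^{1-2i}(1-q^i)(1-q^{i-d-1})(r_1-s^*q^i)(r_2-s^*q^i)/s^*$ ($1\le i\le d$). *)

theory Defs
  imports "HOL-Analysis.Analysis"
begin

text \<open>
  The vertex set \<open>X\<close> is a type \<open>'a\<close> of class finite, the graph is its adjacency relation
  \<open>adj\<close>, matrices indexed by \<open>X\<close> have type \<open>complex ^ 'a ^ 'a\<close>, and \<open>\<V> = complex ^ 'a\<close>.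
  Complex-linear notions on \<open>\<V>\<close> are those of the interpretation \<open>vec\<close>
  (\<open>vec.subspace\<close>, \<open>vec.span\<close>, \<open>vec.dim\<close>); the unqualified constants are real-linear.
\<close>

section \<open>Distance-regular graphs\<close>

definition connected_simple_graph :: "('a \<Rightarrow> 'a \<Rightarrow> bool) \<Rightarrow> bool" where
  "connected_simple_graph adj \<longleftrightarrow> symp adj \<and> irreflp adj \<and> (\<forall>y z. adj\<^sup>*\<^sup>* y z)"

definition gdist :: "('a \<Rightarrow> 'a \<Rightarrow> bool) \<Rightarrow> 'a \<Rightarrow> 'a \<Rightarrow> nat" where
  "gdist adj y z = (LEAST n. (adj ^^ n) y z)"

definition diam :: "('a::finite \<Rightarrow> 'a \<Rightarrow> bool) \<Rightarrow> nat" where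
  "diam adj = Max {gdist adj y z | y z. True}"

definition sphere_at :: "('a \<Rightarrow> 'a \<Rightarrow> bool) \<Rightarrow> nat \<Rightarrow> 'a \<Rightarrow> 'a set" where
  "sphere_at adj i y = {z. gdist adj y z = i}"

definition distance_regular :: "('a::finite \<Rightarrow> 'a \<Rightarrow> bool) \<Rightarrow> bool" where
  "distance_regular adj \<longleftrightarrow>
     (\<forall>i j y z y' z'. gdist adj y z = gdist adj y' z' \<longrightarrow>
        card (sphere_at adj i y \<inter> sphere_at adj j z) =
        card (sphere_at adj i y' \<inter> sphere_at adj j z'))"

text \<open>\<open>inter_num adj h i j\<close> is \<open>p\<^sup>h\<^sub>i\<^sub>j\<close>; it is meaningful for distance-regular
  \<open>adj\<close> and \<open>h \<le> diam adj\<close>.\<close>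

definition inter_num :: "('a::finite \<Rightarrow> 'a \<Rightarrow> bool) \<Rightarrow> nat \<Rightarrow> nat \<Rightarrow> nat \<Rightarrow> nat" where
  "inter_num adj h i j =
     (THE n. \<forall>y z. gdist adj y z = h \<longrightarrow> card (sphere_at adj i y \<inter> sphere_at adj j z) = n)"

definition valency :: "('a::finite \<Rightarrow> 'a \<Rightarrow> bool) \<Rightarrow> nat" where
  "valency adj = inter_num adj 0 1 1"  \<comment> \<open>\<open>b\<^sub>0\<close>\<close>

section \<open>Matrices, generated algebras and modules\<close>

definition smat :: "complex \<Rightarrow> complex ^ 'a ^ 'a \<Rightarrow> complex ^ 'a ^ 'a" where
  "smat c M = (\<chi> y z. c * M $ y $ z)"

definition diag_mat :: "('a \<Rightarrow> complex) \<Rightarrow> complex ^ 'a ^ 'a" where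
  "diag_mat f = (\<chi> y z. if y = z then f z else 0)"

definition char_vec :: "'a set \<Rightarrow> complex ^ 'a" where
  "char_vec Y = (\<chi> z. if z \<in> Y then 1 else 0)"

definition herm :: "complex ^ 'a \<Rightarrow> complex ^ 'a \<Rightarrow> complex" where
  "herm u v = (\<Sum>z\<in>UNIV. u $ z * cnj (v $ z))"

definition orth_compl_in :: "(complex ^ 'a) set \<Rightarrow> (complex ^ 'a) set \<Rightarrow> (complex ^ 'a) set" where
  "orth_compl_in W U = {w \<in> W. \<forall>u\<in>U. herm w u = 0}"

inductive_set generated_algebra ::
  "(complex ^ 'a ^ 'a) set \<Rightarrow> (complex ^ 'a ^ 'a) set"
  for S :: "(complex ^ 'a ^ 'a) set" where
  gen: "M \<in> S \<Longrightarrow> M \<in> generated_algebra S"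
| one: "mat 1 \<in> generated_algebra S"
| add: "M \<in> generated_algebra S \<Longrightarrow> N \<in> generated_algebra S \<Longrightarrow> M + N \<in> generated_algebra S"
| smult: "M \<in> generated_algebra S \<Longrightarrow> smat c M \<in> generated_algebra S"
| mult: "M \<in> generated_algebra S \<Longrightarrow> N \<in> generated_algebra S \<Longrightarrow> M ** N \<in> generated_algebra S"

definition orbit_space :: "(complex ^ 'a ^ 'a) set \<Rightarrow> complex ^ 'a \<Rightarrow> (complex ^ 'a) set" where
  "orbit_space R v = {M *v v | M. M \<in> R}"

definition is_module :: "(complex ^ 'a ^ 'a) set \<Rightarrow> (complex ^ 'a) set \<Rightarrow> bool" where
  "is_module R U \<longleftrightarrow> vec.subspace U \<and> (\<forall>M\<in>R. \<forall>u\<in>U. M *v u \<in> U)"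

definition irreducible_module :: "(complex ^ 'a ^ 'a) set \<Rightarrow> (complex ^ 'a) set \<Rightarrow> bool" where
  "irreducible_module R U \<longleftrightarrow>
     is_module R U \<and> U \<noteq> {0} \<and> (\<forall>U'. is_module R U' \<and> U' \<subseteq> U \<longrightarrow> U' = {0} \<or> U' = U)"

section \<open>Bose-Mesner algebra and Q-polynomial structures\<close>

definition adj_mat :: "('a \<Rightarrow> 'a \<Rightarrow> bool) \<Rightarrow> complex ^ 'a ^ 'a" where
  "adj_mat adj = (\<chi> y z. if adj y z then 1 else 0)"

definition bose_mesner :: "('a::finite \<Rightarrow> 'a \<Rightarrow> bool) \<Rightarrow> (complex ^ 'a ^ 'a) set" where
  "bose_mesner adj = generated_algebra {adj_mat adj}"

text \<open>The primitive idempotents of a commutative semisimple matrix algebra: its basis of mutually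
  orthogonal idempotents summing to the identity.\<close>

definition primitive_idempotents ::
  "(complex ^ 'a ^ 'a) set \<Rightarrow> nat \<Rightarrow> (nat \<Rightarrow> complex ^ 'a ^ 'a) \<Rightarrow> bool" where
  "primitive_idempotents R n E \<longleftrightarrow>
     R = {\<Sum>i\<le>n. smat (c i) (E i) | c. True} \<and>
     (\<forall>i\<le>n. E i \<noteq> 0) \<and>
     (\<forall>i\<le>n. \<forall>j\<le>n. E i ** E j = (if i = j then E i else 0)) \<and>
     (\<Sum>i\<le>n. E i) = mat 1"

text \<open>In the next definition \<open>E i * E j\<close> is the entrywise product (multiplication on \<open>vec\<close>
  is componentwise), and \<open>kr h i j\<close> is the Krein parameter \<open>q\<^sup>h\<^sub>i\<^sub>j\<close>.\<close>

definition Q_polynomial :: "nat \<Rightarrow> (nat \<Rightarrow> complex ^ 'a ^ 'a) \<Rightarrow> bool" where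
  "Q_polynomial d E \<longleftrightarrow>
     (\<exists>kr :: nat \<Rightarrow> nat \<Rightarrow> nat \<Rightarrow> complex.
       (\<forall>i\<le>d. \<forall>j\<le>d. E i * E j = smat (1 / of_nat CARD('a)) (\<Sum>h\<le>d. smat (kr h i j) (E h))) \<and>
       (\<forall>h\<le>d. \<forall>i\<le>d. \<forall>j\<le>d.
          (h > i + j \<or> i > h + j \<or> j > h + i \<longrightarrow> kr h i j = 0) \<and>
          (h = i + j \<or> i = h + j \<or> j = h + i \<longrightarrow> kr h i j \<noteq> 0)))"

text \<open>\<open>dual_adj E1 y\<close> is \<open>A\<^sup>*(y)\<close>, for \<open>E1\<close> the idempotent \<open>E\<^sub>1\<close>.\<close>

definition dual_adj :: "complex ^ 'a ^ 'a \<Rightarrow> 'a \<Rightarrow> complex ^ 'a ^ 'a" where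
  "dual_adj E1 y = diag_mat (\<lambda>z. of_nat CARD('a) * E1 $ y $ z)"

definition dual_idem :: "('a \<Rightarrow> 'a \<Rightarrow> bool) \<Rightarrow> 'a \<Rightarrow> nat \<Rightarrow> complex ^ 'a ^ 'a" where
  "dual_idem adj x i = diag_mat (\<lambda>z. if gdist adj x z = i then 1 else 0)"

section \<open>Delsarte cliques\<close>

text \<open>\<open>\<theta>min\<close> is the least eigenvalue of the graph.\<close>

definition delsarte_clique :: "('a::finite \<Rightarrow> 'a \<Rightarrow> bool) \<Rightarrow> real \<Rightarrow> 'a set \<Rightarrow> bool" where
  "delsarte_clique adj \<theta>min C \<longleftrightarrow>
     C \<noteq> {} \<and> (\<forall>y\<in>C. \<forall>z\<in>C. y \<noteq> z \<longrightarrow> adj y z) \<and>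
     real (card C) = 1 - real (valency adj) / \<theta>min"

definition clique_layer :: "('a::finite \<Rightarrow> 'a \<Rightarrow> bool) \<Rightarrow> 'a set \<Rightarrow> nat \<Rightarrow> 'a set" where
  "clique_layer adj C i = {y. Min (gdist adj y ` C) = i}"

definition clique_layer_minus :: "('a::finite \<Rightarrow> 'a \<Rightarrow> bool) \<Rightarrow> 'a set \<Rightarrow> 'a \<Rightarrow> nat \<Rightarrow> 'a set" where
  "clique_layer_minus adj C x i = clique_layer adj C i \<inter> sphere_at adj i x"

definition clique_layer_plus :: "('a::finite \<Rightarrow> 'a \<Rightarrow> bool) \<Rightarrow> 'a set \<Rightarrow> 'a \<Rightarrow> nat \<Rightarrow> 'a set" where
  "clique_layer_plus adj C x i = clique_layer adj C i \<inter> sphere_at adj (i + 1) x"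

definition W_space :: "('a::finite \<Rightarrow> 'a \<Rightarrow> bool) \<Rightarrow> nat \<Rightarrow> 'a set \<Rightarrow> 'a \<Rightarrow> (complex ^ 'a) set" where
  "W_space adj d C x =
     vec.span ((\<lambda>i. char_vec (clique_layer_minus adj C x i)) ` {0..d - 1} \<union>
               (\<lambda>i. char_vec (clique_layer_plus adj C x i)) ` {0..d - 1})"

definition clique_dual_adj :: "complex ^ 'a ^ 'a \<Rightarrow> 'a set \<Rightarrow> complex ^ 'a ^ 'a" where
  "clique_dual_adj E1 C = smat (1 / of_nat (card C)) (\<Sum>y\<in>C. dual_adj E1 y)"

text \<open>The algebra generated by \<open>A\<close> and the dual adjacency matrix of the clique.\<close>

definition T_tilde ::
  "('a::finite \<Rightarrow> 'a \<Rightarrow> bool) \<Rightarrow> complex ^ 'a ^ 'a \<Rightarrow> 'a set \<Rightarrow> (complex ^ 'a ^ 'a) set" where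
  "T_tilde adj E1 C = generated_algebra {adj_mat adj, clique_dual_adj E1 C}"

section \<open>Leonard systems\<close>

text \<open>Endomorphisms of the underlying space \<open>V\<close>, a subspace of \<open>complex ^ 'a\<close>, are represented by
  matrices acting on \<open>V\<close>; only their restriction to \<open>V\<close> matters.

  On \<open>V\<close>, the matrices \<open>F 0, \<dots>, F n\<close> are the spectral projections of \<open>B\<close> for the distinct
  eigenvalues \<open>\<theta> 0, \<dots>, \<theta> n\<close>.\<close>

definition spectral_idempotents ::
  "(complex ^ 'a) set \<Rightarrow> nat \<Rightarrow> complex ^ 'a ^ 'a \<Rightarrow> (nat \<Rightarrow> complex ^ 'a ^ 'a) \<Rightarrow>
   (nat \<Rightarrow> complex) \<Rightarrow> bool" where
  "spectral_idempotents V n B F \<theta> \<longleftrightarrow>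
     inj_on \<theta> {..n} \<and>
     (\<forall>i\<le>n. (\<forall>v\<in>V. F i *v v \<in> V \<and> B *v (F i *v v) = \<theta> i *s (F i *v v)) \<and>
             (\<exists>v\<in>V. F i *v v \<noteq> 0)) \<and>
     (\<forall>i\<le>n. \<forall>j\<le>n. \<forall>v\<in>V. F i *v (F j *v v) = (if i = j then F i *v v else 0)) \<and>
     (\<forall>v\<in>V. (\<Sum>i\<le>n. F i *v v) = v)"

definition tridiagonal_on ::
  "(complex ^ 'a) set \<Rightarrow> nat \<Rightarrow> (nat \<Rightarrow> complex ^ 'a ^ 'a) \<Rightarrow> complex ^ 'a ^ 'a \<Rightarrow> bool" where
  "tridiagonal_on V n F B \<longleftrightarrow>
     (\<forall>i\<le>n. \<forall>j\<le>n.
        (i > j + 1 \<or> j > i + 1 \<longrightarrow> (\<forall>v\<in>V. F i *v (B *v (F j *v v)) = 0)) \<and>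
        (i = j + 1 \<or> j = i + 1 \<longrightarrow> (\<exists>v\<in>V. F i *v (B *v (F j *v v)) \<noteq> 0)))"

text \<open>\<open>(B; B\<^sup>*; F; F\<^sup>*)\<close> is a Leonard system on \<open>V\<close> of diameter \<open>n\<close>, with eigenvalue
  sequence \<open>\<theta>\<close> and dual eigenvalue sequence \<open>\<theta>s\<close>.\<close>

definition leonard_system ::
  "(complex ^ 'a) set \<Rightarrow> nat \<Rightarrow> complex ^ 'a ^ 'a \<Rightarrow> complex ^ 'a ^ 'a \<Rightarrow>
   (nat \<Rightarrow> complex ^ 'a ^ 'a) \<Rightarrow> (nat \<Rightarrow> complex ^ 'a ^ 'a) \<Rightarrow>
   (nat \<Rightarrow> complex) \<Rightarrow> (nat \<Rightarrow> complex) \<Rightarrow> bool" where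
  "leonard_system V n B Bs F Fs \<theta> \<theta>s \<longleftrightarrow>
     vec.subspace V \<and> vec.dim V = n + 1 \<and>
     spectral_idempotents V n B F \<theta> \<and> spectral_idempotents V n Bs Fs \<theta>s \<and>
     tridiagonal_on V n F Bs \<and> tridiagonal_on V n Fs B"

text \<open>The matrix of an endomorphism in a basis has the coordinates of the image of the
  \<open>j\<close>-th basis vector as its \<open>j\<close>-th column: with subdiagonal entries 1, \<open>B\<close> sends \<open>u j\<close> to
  \<open>\<theta> j u j + u (j + 1)\<close>.  Only \<open>\<phi> 1, \<dots>, \<phi> n\<close> are relevant.\<close>

definition split_sequence ::
  "(complex ^ 'a) set \<Rightarrow> nat \<Rightarrow> complex ^ 'a ^ 'a \<Rightarrow> complex ^ 'a ^ 'a \<Rightarrow>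
   (nat \<Rightarrow> complex) \<Rightarrow> (nat \<Rightarrow> complex) \<Rightarrow> (nat \<Rightarrow> complex) \<Rightarrow> bool" where
  "split_sequence V n B Bs \<theta> \<theta>s \<phi> \<longleftrightarrow>
     (\<forall>i\<in>{1..n}. \<phi> i \<noteq> 0) \<and>
     (\<exists>u :: nat \<Rightarrow> complex ^ 'a.
        inj_on u {..n} \<and> vec.independent (u ` {..n}) \<and> vec.span (u ` {..n}) = V \<and>
        (\<forall>j\<le>n. B *v u j = \<theta> j *s u j + (if j < n then u (j + 1) else 0)) \<and>
        (\<forall>j\<le>n. Bs *v u j = \<theta>s j *s u j + (if 0 < j then \<phi> j *s u (j - 1) else 0)))"

text \<open>The second split sequence \<open>\<phi>2\<close> is the first split sequence of the Leonard system with
  \<open>F i\<close> replaced by \<open>F (n - i)\<close>, whose eigenvalue sequence is \<open>\<theta> n, \<dots>, \<theta> 0\<close>.\<close>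

definition parameter_array ::
  "(complex ^ 'a) set \<Rightarrow> nat \<Rightarrow> complex ^ 'a ^ 'a \<Rightarrow> complex ^ 'a ^ 'a \<Rightarrow>
   (nat \<Rightarrow> complex ^ 'a ^ 'a) \<Rightarrow> (nat \<Rightarrow> complex ^ 'a ^ 'a) \<Rightarrow>
   (nat \<Rightarrow> complex) \<Rightarrow> (nat \<Rightarrow> complex) \<Rightarrow> (nat \<Rightarrow> complex) \<Rightarrow> (nat \<Rightarrow> complex) \<Rightarrow> bool" where
  "parameter_array V n B Bs F Fs \<theta> \<theta>s \<phi>1 \<phi>2 \<longleftrightarrow>
     leonard_system V n B Bs F Fs \<theta> \<theta>s \<and>
     split_sequence V n B Bs \<theta> \<theta>s \<phi>1 \<and>
     split_sequence V n B Bs (\<lambda>i. \<theta> (n - i)) \<theta>s \<phi>2"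

definition q_Racah ::
  "nat \<Rightarrow> complex \<Rightarrow> complex \<Rightarrow> complex \<Rightarrow> complex \<Rightarrow> complex \<Rightarrow> complex \<Rightarrow> complex \<Rightarrow>
   (nat \<Rightarrow> complex) \<Rightarrow> (nat \<Rightarrow> complex) \<Rightarrow> (nat \<Rightarrow> complex) \<Rightarrow> (nat \<Rightarrow> complex) \<Rightarrow> bool" where
  "q_Racah d q h hs s ss r1 r2 \<theta> \<theta>s \<phi>1 \<phi>2 \<longleftrightarrow>
     h \<noteq> 0 \<and> hs \<noteq> 0 \<and> s \<noteq> 0 \<and> ss \<noteq> 0 \<and> r1 \<noteq> 0 \<and> r2 \<noteq> 0 \<and>
     r1 * r2 = s * ss * q ^ (d + 1) \<and>
     (\<forall>i\<in>{1..d}. q ^ i \<noteq> 1 \<and> r1 * q ^ i \<noteq> 1 \<and> r2 * q ^ i \<noteq> 1 \<and>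
                  ss * q ^ i / r1 \<noteq> 1 \<and> ss * q ^ i / r2 \<noteq> 1) \<and>
     (\<forall>i\<in>{2..2 * d}. s * q ^ i \<noteq> 1 \<and> ss * q ^ i \<noteq> 1) \<and>
     (\<forall>i\<le>d. \<theta> i = \<theta> 0 + h * (1 - q ^ i) * (1 - s * q ^ (i + 1)) * q powi (- int i)) \<and>
     (\<forall>i\<le>d. \<theta>s i = \<theta>s 0 + hs * (1 - q ^ i) * (1 - ss * q ^ (i + 1)) * q powi (- int i)) \<and>
     (\<forall>i\<in>{1..d}. \<phi>1 i = h * hs * q powi (1 - 2 * int i) * (1 - q ^ i) *
         (1 - q powi (int i - int d - 1)) * (1 - r1 * q ^ i) * (1 - r2 * q ^ i)) \<and>
     (\<forall>i\<in>{1..d}. \<phi>2 i = h * hs * q powi (1 - 2 * int i) * (1 - q ^ i) *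
         (1 - q powi (int i - int d - 1)) * (r1 - ss * q ^ i) * (r2 - ss * q ^ i) / ss)"

end

theory Submission
  imports Defs
begin

text \<open>
  Let \<open>D y\<close> be the distance from a vertex \<open>y\<close> to the clique \<open>C\<close>.  The distance from \<open>y\<close> to
  any vertex of \<open>C\<close> is \<open>D y\<close> or \<open>D y + 1\<close>, so \<open>D y\<close> and the distance to \<open>x\<close> divide each layer
  of the clique into two cells.  All the cells are nonempty (\<open>minus_nonempty\<close>,
  \<open>plus_nonempty\<close>), and the space \<open>W\<close> consists of the vectors that are constant on the cells.
  It is invariant under the adjacency matrix because it is the sum of the cyclic modules of \<open>x\<close>
  and of \<open>C\<close> (\<open>W_eq_sum_orbits\<close>).  The cyclic module of \<open>C\<close> consists of the vectors that are
  constant on the layers, so its orthogonal complement in \<open>W\<close> has a basis with one vector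
  \<open>cellvec i\<close> for each layer, of sum zero on that layer.

  The dual adjacency matrix of the clique is a scalar \<open>\<psi> i\<close> on the layer \<open>i\<close>.  If these scalars
  are distinct, then a nonzero submodule of the complement contains some \<open>cellvec i\<close>.  Counting
  neighbours shows that \<open>A (cellvec i)\<close> has nonzero components at \<open>cellvec (i - 1)\<close> and
  \<open>cellvec (i + 1)\<close>, so the submodule is everything (\<open>irreducible_complement\<close>).

  It remains to compute \<open>\<psi>\<close>, together with the number \<open>N y\<close> of vertices of \<open>C\<close> nearest to \<open>y\<close>.
  The cardinality of \<open>C\<close> makes its characteristic vector orthogonal to the columns of \<open>E d\<close>
  (\<open>delsarte_clique_annihilated\<close>).  If \<open>e i\<close> denotes the entry of \<open>E d\<close> at two vertices at
  distance \<open>i\<close>, this says \<open>N y e i + (|C| - N y) e (i + 1) = 0\<close> for \<open>i = D y\<close>.  Comparing the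
  two split bases of the cyclic module of \<open>x\<close> gives \<open>e (i + 1) / e i = \<phi>2 (i + 1) / \<phi>1 (i + 1)\<close>
  (\<open>last_idempotent_entries\<close>).  Hence \<open>N y\<close> depends only on \<open>i\<close>, and \<open>\<psi> i\<close> is an explicit
  combination of \<open>\<theta>s i\<close> and \<open>\<theta>s (i + 1)\<close>.  For parameters of q-Racah type it has the form
  \<open>a + b (q^(-i) + ss q^(i + 2))\<close> with \<open>b \<noteq> 0\<close>, and the restrictions on the parameters make
  these values distinct (\<open>q_Racah_clique_dual_inj\<close>).
\<close>

section \<open>Distance in a connected graph\<close>

locale connected_graph =
  fixes adj :: "'a::finite \<Rightarrow> 'a \<Rightarrow> bool"
  assumes graph: "connected_simple_graph adj"
begin

lemma adj_sym: "adj y z \<Longrightarrow> adj z y"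
  using graph unfolding connected_simple_graph_def by (auto dest: sympD)

lemma relpowp_gdist: "(adj ^^ gdist adj y z) y z"
proof -
  have "adj\<^sup>*\<^sup>* y z"
    using graph unfolding connected_simple_graph_def by blast
  then obtain n where "(adj ^^ n) y z"
    using rtranclp_imp_relpowp by metis
  then show ?thesis
    unfolding gdist_def by (rule LeastI)
qed

lemma gdist_le: "(adj ^^ n) y z \<Longrightarrow> gdist adj y z \<le> n"
  unfolding gdist_def by (rule Least_le)

lemma gdist_eq_0_iff [simp]: "gdist adj y z = 0 \<longleftrightarrow> y = z"
proof
  assume "gdist adj y z = 0"
  then show "y = z" using relpowp_gdist[of y z] by simp
next
  assume "y = z"
  then show "gdist adj y z = 0" using gdist_le[of 0 y z] by simp
qed

lemma gdist_self [simp]: "gdist adj y y = 0"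
  by simp

lemma relpowp_adj_sym: "(adj ^^ n) y z \<Longrightarrow> (adj ^^ n) z y"
proof (induction n arbitrary: z)
  case (Suc n)
  then obtain w where "(adj ^^ n) y w" "adj w z" by auto
  then show ?case
    using Suc.IH adj_sym relpowp_Suc_I2 by metis
qed simp

lemma gdist_commute: "gdist adj y z = gdist adj z y"
  using gdist_le relpowp_gdist relpowp_adj_sym by (metis le_antisym)

lemma gdist_adj_le: "adj z w \<Longrightarrow> gdist adj y w \<le> Suc (gdist adj y z)"
  using gdist_le relpowp_Suc_I relpowp_gdist by metis

lemma gdist_adj_le': "adj z w \<Longrightarrow> gdist adj w y \<le> Suc (gdist adj z y)"
  using gdist_adj_le[of z w y] by (simp add: gdist_commute)

lemma gdist_step:
  assumes "gdist adj y w = Suc n"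
  obtains z where "gdist adj y z = n" "adj z w"
proof -
  have "(adj ^^ Suc n) y w"
    using relpowp_gdist[of y w] assms by simp
  then obtain z where z: "(adj ^^ n) y z" "adj z w" by auto
  then have "gdist adj y z = n"
    using gdist_le[OF z(1)] gdist_adj_le[OF z(2), of y] assms by simp
  then show thesis using that z by blast
qed

lemma adj_iff_gdist: "adj y z \<longleftrightarrow> gdist adj y z = 1"
proof
  assume a: "adj y z"
  then have "y \<noteq> z"
    using graph unfolding connected_simple_graph_def by (auto dest: irreflpD)
  moreover have "gdist adj y z \<le> 1"
    using gdist_adj_le[OF a, of y] by (metis One_nat_def gdist_eq_0_iff)
  ultimately show "gdist adj y z = 1"
    using gdist_eq_0_iff by (metis le_neq_implies_less less_one)
next
  assume "gdist adj y z = 1"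
  then show "adj y z" using relpowp_gdist[of y z] by (auto simp: relpowp.simps eq_OO)
qed

lemma gdist_le_diam: "gdist adj y z \<le> diam adj"
proof -
  have "{gdist adj y z |y z. True} = (\<lambda>(y, z). gdist adj y z) ` UNIV" by auto
  then have "finite {gdist adj y z |y z. True}" by simp
  then show ?thesis
    unfolding diam_def by (intro Max_ge) auto
qed

lemma ex_gdist_diam: "\<exists>y z. gdist adj y z = diam adj"
proof -
  have "{gdist adj y z |y z. True} = (\<lambda>(y, z). gdist adj y z) ` UNIV" by auto
  then have "finite {gdist adj y z |y z. True}" by simp
  then have "Max {gdist adj y z |y z. True} \<in> {gdist adj y z |y z. True}"
    by (intro Max_in) auto
  then obtain y z where "Max {gdist adj y z |y z. True} = gdist adj y z" by blast
  then show ?thesis unfolding diam_def by metis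
qed

lemma ex_gdist_below: "gdist adj y z = n \<Longrightarrow> i \<le> n \<Longrightarrow> \<exists>w. gdist adj y w = i"
proof (induction n arbitrary: z)
  case (Suc n)
  then show ?case
    by (metis gdist_step le_Suc_eq)
qed auto

text \<open>The distance from a vertex to a nonempty set of vertices.\<close>

definition set_dist :: "'a set \<Rightarrow> 'a \<Rightarrow> nat" where
  "set_dist Y y = Min (gdist adj y ` Y)"

lemma set_dist_le: "z \<in> Y \<Longrightarrow> set_dist Y y \<le> gdist adj y z"
  unfolding set_dist_def by (intro Min_le) auto

lemma set_dist_attained:
  assumes "Y \<noteq> {}"
  obtains z where "z \<in> Y" "gdist adj y z = set_dist Y y"
proof -
  have "Min (gdist adj y ` Y) \<in> gdist adj y ` Y"
    using assms by (intro Min_in) auto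
  then show thesis using that unfolding set_dist_def by auto
qed

lemma set_dist_adj_le:
  assumes "Y \<noteq> {}" "adj y w"
  shows "set_dist Y w \<le> Suc (set_dist Y y)"
proof -
  obtain z where z: "z \<in> Y" "gdist adj y z = set_dist Y y"
    using set_dist_attained[OF assms(1)] .
  have "set_dist Y w \<le> gdist adj w z"
    using set_dist_le z by simp
  also have "\<dots> \<le> Suc (gdist adj y z)"
    using gdist_adj_le'[OF assms(2)] .
  finally show ?thesis using z by simp
qed

lemma set_dist_step:
  assumes "Y \<noteq> {}" "set_dist Y y = Suc n"
  obtains w where "adj y w" "set_dist Y w = n"
proof -
  obtain z where z: "z \<in> Y" "gdist adj y z = Suc n"
    using set_dist_attained[OF assms(1), of y] assms(2) by auto
  then have "gdist adj z y = Suc n" by (simp add: gdist_commute)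
  then obtain w where w: "gdist adj z w = n" "adj w y"
    by (rule gdist_step)
  have "set_dist Y w \<le> n"
    using set_dist_le[OF z(1), of w] w by (simp add: gdist_commute)
  moreover have "Suc n \<le> Suc (set_dist Y w)"
    using set_dist_adj_le[OF assms(1) w(2)] assms(2) by simp
  ultimately show thesis
    using that[of w] adj_sym[OF w(2)] by simp
qed

lemma set_dist_eq_0_iff: "Y \<noteq> {} \<Longrightarrow> set_dist Y y = 0 \<longleftrightarrow> y \<in> Y"
  by (metis gdist_eq_0_iff le_zero_eq set_dist_attained set_dist_le)

lemma set_dist_singleton [simp]: "set_dist {x} y = gdist adj x y"
  by (simp add: set_dist_def gdist_commute)

lemma gdist_clique:
  assumes adj_clique: "\<And>y z. y \<in> C \<Longrightarrow> z \<in> C \<Longrightarrow> y \<noteq> z \<Longrightarrow> adj y z"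
    and z: "z \<in> C"
  shows "gdist adj y z = set_dist C y \<or> gdist adj y z = Suc (set_dist C y)"
proof -
  obtain w where w: "w \<in> C" "gdist adj y w = set_dist C y"
    using set_dist_attained[of C y] z by blast
  have "gdist adj y z \<le> Suc (gdist adj y w)"
    using gdist_adj_le adj_clique[OF w(1) z] by (cases "w = z") auto
  then show ?thesis
    using w set_dist_le[OF z, of y] by linarith
qed

text \<open>A sum over a clique of a function of the distance to \<open>y\<close> takes only two values of that
  function into account.\<close>

lemma sum_clique_gdist:
  fixes f :: "nat \<Rightarrow> complex"
  assumes adj_clique: "\<And>y z. y \<in> C \<Longrightarrow> z \<in> C \<Longrightarrow> y \<noteq> z \<Longrightarrow> adj y z"
  shows "(\<Sum>z\<in>C. f (gdist adj y z)) =
      of_nat (card {z \<in> C. gdist adj y z = set_dist C y}) * f (set_dist C y) +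
      (of_nat (card C) - of_nat (card {z \<in> C. gdist adj y z = set_dist C y})) *
        f (Suc (set_dist C y))"
proof -
  let ?N = "{z \<in> C. gdist adj y z = set_dist C y}"
  have "(\<Sum>z\<in>C. f (gdist adj y z)) =
      (\<Sum>z\<in>?N. f (gdist adj y z)) + (\<Sum>z\<in>C - ?N. f (gdist adj y z))"
    by (subst add.commute, rule sum.subset_diff) auto
  also have "(\<Sum>z\<in>?N. f (gdist adj y z)) = (\<Sum>z\<in>?N. f (set_dist C y))"
    by (rule sum.cong) auto
  also have "(\<Sum>z\<in>C - ?N. f (gdist adj y z)) = (\<Sum>z\<in>C - ?N. f (Suc (set_dist C y)))"
  proof (rule sum.cong[OF refl])
    fix z assume z: "z \<in> C - ?N"
    then have "gdist adj y z = set_dist C y \<or> gdist adj y z = Suc (set_dist C y)"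
      by (intro gdist_clique adj_clique) auto
    then show "f (gdist adj y z) = f (Suc (set_dist C y))" using z by auto
  qed
  also have "\<dots> = (of_nat (card C) - of_nat (card ?N)) * f (Suc (set_dist C y))"
    by (simp add: card_Diff_subset of_nat_diff card_mono)
  finally show ?thesis by simp
qed

lemma clique_layer_eq: "clique_layer adj Y i = {y. set_dist Y y = i}"
  by (simp add: clique_layer_def set_dist_def)

end


section \<open>The Bose-Mesner algebra\<close>

lemma smat_mult_vector [simp]: "smat c M *v v = c *s (M *v v)"
  by (simp add: smat_def matrix_vector_mult_def vec_eq_iff sum_distrib_left mult.assoc)

lemma diag_mat_mult_vector: "(diag_mat f *v v) $ y = f y * v $ y"
  by (simp add: diag_mat_def matrix_vector_mult_def if_distrib[of "\<lambda>a. a * _"]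
      sum.delta cong: if_cong)

lemma smat_nth [simp]: "smat c M $ y $ z = c * M $ y $ z"
  by (simp add: smat_def)

lemma mat_vec_char_vec: "(M *v char_vec Y) $ y = (\<Sum>z\<in>Y. M $ y $ z)"
  by (simp add: matrix_vector_mult_def char_vec_def if_distrib[of "(*) _"] sum.If_cases
      cong: if_cong)

lemma adj_mat_mult_vector: "(adj_mat adj *v v) $ y = (\<Sum>z | adj y z. v $ z)"
  by (simp add: adj_mat_def matrix_vector_mult_def if_distrib[of "\<lambda>a. a * _"] sum.If_cases
      cong: if_cong)

lemma sum_vec_mult: "(\<Sum>i\<in>I. M i) *v v = (\<Sum>i\<in>I. M i *v (v :: complex ^ 'a::finite))"
  by (induction I rule: infinite_finite_induct) (auto simp: matrix_vector_mult_add_rdistrib)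

lemma subspace_orbit_space: "vec.subspace (orbit_space (bose_mesner adj) v)"
  unfolding vec.subspace_def
proof (intro conjI ballI allI)
  have "smat 0 (mat 1) \<in> bose_mesner adj"
    unfolding bose_mesner_def by (intro generated_algebra.intros)
  then show "0 \<in> orbit_space (bose_mesner adj) v"
    unfolding orbit_space_def by (force intro!: exI[of _ "smat 0 (mat 1)"])
next
  fix u w assume "u \<in> orbit_space (bose_mesner adj) v" "w \<in> orbit_space (bose_mesner adj) v"
  then show "u + w \<in> orbit_space (bose_mesner adj) v"
    unfolding orbit_space_def bose_mesner_def
    by (force simp: matrix_vector_mult_add_rdistrib[symmetric] intro: generated_algebra.add)
next
  fix c u assume "u \<in> orbit_space (bose_mesner adj) v"
  then obtain M where "M \<in> bose_mesner adj" "u = M *v v"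
    unfolding orbit_space_def by auto
  then show "c *s u \<in> orbit_space (bose_mesner adj) v"
    unfolding orbit_space_def bose_mesner_def
    by (auto intro!: exI[of _ "smat c M"] generated_algebra.smult)
qed

lemma self_in_orbit_space: "v \<in> orbit_space (bose_mesner adj) v"
  unfolding orbit_space_def bose_mesner_def
  by (force intro!: exI[of _ "mat 1"] generated_algebra.one)

lemma adj_mat_orbit_space:
  "u \<in> orbit_space (bose_mesner adj) v \<Longrightarrow> adj_mat adj *v u \<in> orbit_space (bose_mesner adj) v"
  unfolding orbit_space_def bose_mesner_def
  using generated_algebra.mult[OF generated_algebra.gen[of "adj_mat adj"]]
  by (force simp: matrix_vector_mul_assoc)

locale drg = connected_graph +
  assumes regular: "distance_regular adj"
begin

text \<open>Every matrix in the Bose-Mesner algebra is a linear combination of distance matrices.\<close>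

lemma bose_mesner_gdist:
  assumes "M \<in> bose_mesner adj"
  obtains f where "\<And>y z. M $ y $ z = f (gdist adj y z)"
proof -
  have "\<exists>f. \<forall>y z. M $ y $ z = f (gdist adj y z)"
    using assms unfolding bose_mesner_def
  proof (induction rule: generated_algebra.induct)
    case (gen M)
    have "M $ y $ z = (if gdist adj y z = 1 then 1 else 0)" for y z
      using gen adj_iff_gdist[of y z] by (simp add: adj_mat_def)
    then show ?case
      by (intro exI[of _ "\<lambda>i. if i = 1 then 1 else 0"]) simp
  next
    case one
    show ?case
      by (intro exI[of _ "\<lambda>i. if i = 0 then 1 else 0"]) (simp add: mat_def)
  next
    case (add M N)
    then obtain f g where "\<forall>y z. M $ y $ z = f (gdist adj y z)" "\<forall>y z. N $ y $ z = g (gdist adj y z)"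
      by blast
    then show ?case by (intro exI[of _ "\<lambda>i. f i + g i"]) simp
  next
    case (smult M c)
    then obtain f where "\<forall>y z. M $ y $ z = f (gdist adj y z)" by blast
    then show ?case by (intro exI[of _ "\<lambda>i. c * f i"]) simp
  next
    case (mult M N)
    then obtain f g where fg: "\<And>y z. M $ y $ z = f (gdist adj y z)"
      "\<And>y z. N $ y $ z = g (gdist adj y z)"
      by blast
    let ?D = "{..diam adj} \<times> {..diam adj}"
    have *: "(M ** N) $ y $ z =
        (\<Sum>(i, j)\<in>?D. of_nat (card (sphere_at adj i y \<inter> sphere_at adj j z)) * (f i * g j))" for y z
    proof -
      have "(M ** N) $ y $ z = (\<Sum>w\<in>UNIV. f (gdist adj y w) * g (gdist adj z w))"
        by (simp add: matrix_matrix_mult_def fg gdist_commute[of z])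
      also have "\<dots> = (\<Sum>p\<in>?D. \<Sum>w\<in>{w \<in> UNIV. (gdist adj y w, gdist adj z w) = p}.
          f (gdist adj y w) * g (gdist adj z w))"
        by (rule sum.group[symmetric]) (auto simp: gdist_le_diam)
      also have "\<dots> = (\<Sum>(i, j)\<in>?D.
          of_nat (card (sphere_at adj i y \<inter> sphere_at adj j z)) * (f i * g j))"
      proof (rule sum.cong, goal_cases)
        case (2 p)
        obtain i j where p: "p = (i, j)" by (cases p)
        have "{w \<in> UNIV. (gdist adj y w, gdist adj z w) = p} =
            sphere_at adj i y \<inter> sphere_at adj j z"
          by (auto simp: sphere_at_def p)
        moreover have "(\<Sum>w\<in>sphere_at adj i y \<inter> sphere_at adj j z.
            f (gdist adj y w) * g (gdist adj z w)) =
            (\<Sum>w\<in>sphere_at adj i y \<inter> sphere_at adj j z. f i * g j)"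
          by (rule sum.cong) (auto simp: sphere_at_def)
        ultimately show ?case by (simp add: p)
      qed simp
      finally show ?thesis .
    qed
    have eq: "(M ** N) $ y $ z = (M ** N) $ y' $ z'" if "gdist adj y z = gdist adj y' z'"
      for y z y' z'
    proof -
      have "card (sphere_at adj i y \<inter> sphere_at adj j z) =
          card (sphere_at adj i y' \<inter> sphere_at adj j z')" for i j
        using regular that unfolding distance_regular_def by blast
      then show ?thesis unfolding * by simp
    qed
    define p where "p i = (SOME p. gdist adj (fst p) (snd p) = i)" for i
    have "gdist adj (fst (p (gdist adj y z))) (snd (p (gdist adj y z))) = gdist adj y z" for y z
      unfolding p_def by (rule someI[of _ "(y, z)"]) simp
    then have "(M ** N) $ y $ z =
        (M ** N) $ fst (p (gdist adj y z)) $ snd (p (gdist adj y z))" for y z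
      by (intro eq) simp
    then show ?case
      by (intro exI[of _ "\<lambda>i. (M ** N) $ fst (p i) $ snd (p i)"]) blast
  qed
  then show thesis using that by blast
qed

text \<open>Suppose that every vector in the cyclic module generated by the characteristic vector of
  \<open>Y\<close> is constant on the layers around \<open>Y\<close>.  The images of the characteristic vector under the
  powers of the adjacency matrix are then triangular with respect to the layers: the value of
  the \<open>i\<close>-th image at \<open>y\<close> is the number of walks of length \<open>i\<close> from \<open>y\<close> to \<open>Y\<close>, which is zero
  beyond the layer \<open>i\<close> and positive on it.  Hence the module contains all the layers.\<close>

lemma layer_in_orbit:
  assumes Y: "Y \<noteq> {}"
    and const: "\<And>u y y'. u \<in> orbit_space (bose_mesner adj) (char_vec Y) \<Longrightarrow>
      set_dist Y y = set_dist Y y' \<Longrightarrow> u $ y = u $ y'"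
  shows "char_vec {y. set_dist Y y = i} \<in> orbit_space (bose_mesner adj) (char_vec Y)"
proof (induction i rule: less_induct)
  case (less i)
  let ?O = "orbit_space (bose_mesner adj) (char_vec Y)"
  define a where "a n = (((*v) (adj_mat adj)) ^^ n) (char_vec Y)" for n
  have a_orbit: "a n \<in> ?O" for n
    by (induction n) (auto simp: a_def self_in_orbit_space adj_mat_orbit_space)
  have a_Suc: "a (Suc n) $ y = (\<Sum>z | adj y z. a n $ z)" for n y
    by (simp add: a_def adj_mat_mult_vector)
  have a_supp: "a n $ y = 0" if "set_dist Y y > n" for n y
    using that
  proof (induction n arbitrary: y)
    case 0
    then show ?case using set_dist_eq_0_iff[OF Y, of y] by (auto simp: a_def char_vec_def)
  next
    case (Suc n)
    have "a n $ z = 0" if "adj y z" for z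
      using Suc.IH[of z] set_dist_adj_le[OF Y adj_sym[OF that]] Suc.prems by simp
    then show ?case by (simp add: a_Suc)
  qed
  have a_real: "\<exists>r\<ge>0. a n $ y = of_real r \<and> (set_dist Y y = n \<longrightarrow> r > 0)" for n y
  proof (induction n arbitrary: y)
    case 0
    show ?case using set_dist_eq_0_iff[OF Y, of y]
      by (intro exI[of _ "if y \<in> Y then 1 else 0"]) (auto simp: a_def char_vec_def)
  next
    case (Suc n)
    then obtain r where r: "\<And>y. r y \<ge> 0" "\<And>y. a n $ y = of_real (r y)"
      "\<And>y. set_dist Y y = n \<Longrightarrow> r y > 0"
      by metis
    have "(\<Sum>z | adj y z. r z) > 0" if sd: "set_dist Y y = Suc n"
    proof -
      obtain w where "adj y w" "set_dist Y w = n"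
        using set_dist_step[OF Y sd] .
      then show ?thesis
        using r by (intro sum_pos2[of _ w]) auto
    qed
    then show ?case
      by (intro exI[of _ "\<Sum>z | adj y z. r z"]) (auto simp: a_Suc r intro!: sum_nonneg)
  qed
  show ?case
  proof (cases "\<exists>y. set_dist Y y = i")
    case False
    then have "char_vec {y. set_dist Y y = i} = 0"
      by (auto simp: char_vec_def vec_eq_iff)
    then show ?thesis
      using vec.subspace_0[OF subspace_orbit_space] by simp
  next
    case True
    then obtain y0 where y0: "set_dist Y y0 = i" by blast
    define g where "g j = a i $ (SOME y. set_dist Y y = j)" for j
    have g: "a i $ y = g (set_dist Y y)" for y
      unfolding g_def by (rule const[OF a_orbit]) (metis (mono_tags, lifting) someI)
    obtain r where "r > 0" "a i $ y0 = of_real r"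
      using a_real[of i y0] y0 by blast
    then have gi: "g i \<noteq> 0" using g[of y0] y0 by simp
    let ?L = "\<lambda>j. char_vec {y. set_dist Y y = j} :: complex ^ 'a"
    have "?L i = (1 / g i) *s (a i - (\<Sum>j<i. g j *s ?L j))"
    proof -
      have "(\<Sum>j<i. g j * (if set_dist Y y = j then 1 else 0)) =
          (if set_dist Y y < i then g (set_dist Y y) else 0)" for y
        by (simp add: if_distrib[of "(*) _"] cong: if_cong)
      moreover have "g (set_dist Y y) = 0" if "set_dist Y y > i" for y
        using a_supp[OF that] g by simp
      ultimately show ?thesis
        using gi by (auto simp: vec_eq_iff char_vec_def g)
    qed
    moreover have "(1 / g i) *s (a i - (\<Sum>j<i. g j *s ?L j)) \<in> ?O"
      using less.IH a_orbit
      by (intro vec.subspace_scale vec.subspace_diff vec.subspace_sum subspace_orbit_space) auto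
    ultimately show ?thesis by simp
  qed
qed

lemma orbit_eq_layer_constant:
  assumes Y: "Y \<noteq> {}"
    and const: "\<And>u y y'. u \<in> orbit_space (bose_mesner adj) (char_vec Y) \<Longrightarrow>
      set_dist Y y = set_dist Y y' \<Longrightarrow> u $ y = u $ y'"
  shows "orbit_space (bose_mesner adj) (char_vec Y) = range (\<lambda>g. \<chi> y. g (set_dist Y y))"
proof (intro equalityI subsetI)
  fix u assume u: "u \<in> orbit_space (bose_mesner adj) (char_vec Y)"
  have "set_dist Y y = set_dist Y (SOME z. set_dist Y z = set_dist Y y)" for y
    by (rule sym, rule someI[of _ y]) simp
  then have "u $ y = u $ (SOME z. set_dist Y z = set_dist Y y)" for y
    by (rule const[OF u])
  then show "u \<in> range (\<lambda>g. \<chi> y. g (set_dist Y y))"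
    by (intro range_eqI[where x = "\<lambda>j. u $ (SOME z. set_dist Y z = j)"]) (simp add: vec_eq_iff)
next
  fix u :: "complex ^ 'a" assume "u \<in> range (\<lambda>g. \<chi> y. g (set_dist Y y))"
  then obtain g where u: "u = (\<chi> y. g (set_dist Y y))" by blast
  have "u = (\<Sum>j\<in>range (set_dist Y). g j *s char_vec {y. set_dist Y y = j})"
    by (auto simp: u vec_eq_iff char_vec_def if_distrib[of "(*) _"] cong: if_cong)
  also have "\<dots> \<in> orbit_space (bose_mesner adj) (char_vec Y)"
    using layer_in_orbit[OF assms]
    by (intro vec.subspace_scale vec.subspace_sum subspace_orbit_space) auto
  finally show "u \<in> orbit_space (bose_mesner adj) (char_vec Y)" .
qed

lemma orbit_vertex_eq:
  "orbit_space (bose_mesner adj) (char_vec {x}) = range (\<lambda>g. \<chi> y. g (gdist adj x y))"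
proof -
  have const: "u $ y = u $ y'"
    if u: "u \<in> orbit_space (bose_mesner adj) (char_vec {x})" and "set_dist {x} y = set_dist {x} y'" for u y y'
  proof -
    obtain M where M: "M \<in> bose_mesner adj" "u = M *v char_vec {x}"
      using u unfolding orbit_space_def by blast
    obtain f where "\<And>y z. M $ y $ z = f (gdist adj y z)"
      using bose_mesner_gdist[OF M(1)] by blast
    then show ?thesis
      using that by (simp add: M mat_vec_char_vec gdist_commute[of _ x])
  qed
  have "orbit_space (bose_mesner adj) (char_vec {x}) = range (\<lambda>g. \<chi> y. g (set_dist {x} y))"
    by (rule orbit_eq_layer_constant, simp, rule const)
  then show ?thesis by simp
qed

end


section \<open>Modules and orthogonal complements\<close>

lemma is_module_generated:
  assumes "vec.subspace U" "\<And>M u. M \<in> S \<Longrightarrow> u \<in> U \<Longrightarrow> M *v u \<in> U"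
  shows "is_module (generated_algebra S) U"
proof -
  have "\<forall>u\<in>U. M *v u \<in> U" if "M \<in> generated_algebra S" for M
    using that
  proof induction
    case (add M N)
    then show ?case
      using assms(1) by (simp add: matrix_vector_mult_add_rdistrib vec.subspace_add)
  next
    case (smult M c)
    then show ?case
      using assms(1) by (simp add: vec.subspace_scale)
  next
    case (mult M N)
    then show ?case
      by (simp add: matrix_vector_mul_assoc[symmetric])
  qed (use assms in auto)
  then show ?thesis using assms(1) unfolding is_module_def by blast
qed

lemma herm_add: "herm (u + v) w = herm u w + herm v w"
  by (simp add: herm_def distrib_right sum.distrib)

lemma herm_scale: "herm (c *s u) w = c * herm u w"
  by (simp add: herm_def sum_distrib_left mult.assoc)

lemma subspace_orth_compl_in:
  "vec.subspace W \<Longrightarrow> vec.subspace (orth_compl_in W U)"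
  unfolding orth_compl_in_def vec.subspace_def
  by (auto simp: herm_add herm_scale) (simp add: herm_def)

lemma (in connected_graph) herm_adj_mat:
  "herm (adj_mat adj *v u) v = herm u (adj_mat adj *v v)"
proof -
  have sym: "adj y z = adj z y" for y z using adj_sym by blast
  have "herm (adj_mat adj *v u) v = (\<Sum>y\<in>UNIV. \<Sum>z | z \<in> UNIV \<and> adj y z. u $ z * cnj (v $ y))"
    by (simp add: herm_def adj_mat_mult_vector sum_distrib_right)
  also have "\<dots> = (\<Sum>z\<in>UNIV. \<Sum>y | y \<in> UNIV \<and> adj y z. u $ z * cnj (v $ y))"
    by (rule sum.swap_restrict) auto
  also have "\<dots> = herm u (adj_mat adj *v v)"
    by (simp add: herm_def adj_mat_mult_vector sum_distrib_left sym[of _ "_::'a"])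
  finally show ?thesis .
qed


section \<open>The partition by the distances to a clique and to one of its vertices\<close>

text \<open>The setting is a clique \<open>C\<close> of covering radius less than \<open>d\<close> and a vertex \<open>x\<close> in it of eccentricity
  \<open>d\<close>, where the number of vertices of \<open>C\<close> nearest to \<open>y\<close> depends only on the distance from
  \<open>y\<close> to \<open>C\<close>.\<close>

locale clique_partition = drg +
  fixes C :: "'a set" and x :: 'a and d :: nat
  assumes base: "x \<in> C"
    and adj_clique: "y \<in> C \<Longrightarrow> z \<in> C \<Longrightarrow> y \<noteq> z \<Longrightarrow> adj y z"
    and set_dist_less: "set_dist C y < d"
    and ex_far: "\<exists>y. gdist adj x y = d"
    and card_nearest: "set_dist C y = set_dist C y' \<Longrightarrow>
      card {z \<in> C. gdist adj y z = set_dist C y} = card {z \<in> C. gdist adj y' z = set_dist C y'}"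
begin

lemma nonempty: "C \<noteq> {}"
  using base by auto

lemma gdist_base: "gdist adj x y = set_dist C y \<or> gdist adj x y = Suc (set_dist C y)"
  using gdist_clique[OF adj_clique base, of y] by (simp add: gdist_commute)

lemma orbit_clique_eq:
  "orbit_space (bose_mesner adj) (char_vec C) = range (\<lambda>g. \<chi> y. g (set_dist C y))"
proof (rule orbit_eq_layer_constant[OF nonempty])
  fix u y y'
  assume u: "u \<in> orbit_space (bose_mesner adj) (char_vec C)"
    and eq: "set_dist C y = set_dist C y'"
  obtain M where M: "M \<in> bose_mesner adj" "u = M *v char_vec C"
    using u unfolding orbit_space_def by blast
  obtain f where f: "\<And>y z. M $ y $ z = f (gdist adj y z)"
    using bose_mesner_gdist[OF M(1)] by blast
  define n where "n y = card {z \<in> C. gdist adj y z = set_dist C y}" for y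
  have "u $ y = of_nat (n y) * f (set_dist C y) +
      (of_nat (card C) - of_nat (n y)) * f (Suc (set_dist C y))" for y
    unfolding n_def M mat_vec_char_vec f by (rule sum_clique_gdist) (rule adj_clique)
  then show "u $ y = u $ y'"
    using card_nearest[OF eq] eq by (simp add: n_def)
qed

text \<open>The cells of the partition: \<open>minus i\<close> and \<open>plus i\<close> are the vertices at distance \<open>i\<close>
  from \<open>C\<close> whose distance to \<open>x\<close> is \<open>i\<close> and \<open>i + 1\<close>, respectively.\<close>

definition minus :: "nat \<Rightarrow> 'a set" where
  "minus i = {y. set_dist C y = i \<and> gdist adj x y = i}"

definition plus :: "nat \<Rightarrow> 'a set" where
  "plus i = {y. set_dist C y = i \<and> gdist adj x y = Suc i}"

lemma minus_eq: "clique_layer_minus adj C x i = minus i"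
  by (auto simp: clique_layer_minus_def clique_layer_eq sphere_at_def minus_def)

lemma plus_eq: "clique_layer_plus adj C x i = plus i"
  by (auto simp: clique_layer_plus_def clique_layer_eq sphere_at_def plus_def)

text \<open>A vertex at distance \<open>d\<close> from \<open>x\<close> is at distance \<open>d - 1\<close> from some other vertex \<open>z\<close>
  of the clique.  Exchanging the roles of \<open>x\<close> and \<open>z\<close>, regularity supplies a vertex in the last
  cell \<open>minus (d - 1)\<close>; shortest paths to \<open>x\<close> or to \<open>C\<close> then meet all the cells.\<close>

lemma plus_nonempty:
  assumes "i < d"
  shows "plus i \<noteq> {}"
proof -
  have *: "plus (d - Suc n) \<noteq> {}" if "n < d" for n
    using that
  proof (induction n)
    case 0
    obtain y where y: "gdist adj x y = d" using ex_far by blast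
    then have "y \<in> plus (d - 1)"
      using gdist_base[of y] set_dist_less[of y] by (auto simp: plus_def)
    then show ?case by auto
  next
    case (Suc n)
    then obtain y where y: "set_dist C y = d - Suc n" "gdist adj x y = Suc (d - Suc n)"
      by (auto simp: plus_def)
    have "set_dist C y = Suc (d - Suc (Suc n))" using y Suc.prems by simp
    then obtain w where w: "adj y w" "set_dist C w = d - Suc (Suc n)"
      using set_dist_step[OF nonempty] by metis
    have "gdist adj x y \<le> Suc (gdist adj x w)"
      using gdist_adj_le adj_sym w(1) by blast
    then have "w \<in> plus (d - Suc (Suc n))"
      using gdist_base[of w] w y Suc.prems by (auto simp: plus_def)
    then show ?case by auto
  qed
  show ?thesis using *[of "d - Suc i"] assms by simp
qed

lemma minus_nonempty:
  assumes "i < d"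
  shows "minus i \<noteq> {}"
proof -
  have *: "minus (d - Suc n) \<noteq> {}" if "n < d" for n
    using that
  proof (induction n)
    case 0
    then obtain y where y: "set_dist C y = d - 1" "gdist adj x y = d"
      using plus_nonempty[of "d - 1"] by (auto simp: plus_def)
    obtain z where z: "z \<in> C" "gdist adj y z = d - 1"
      using set_dist_attained[OF nonempty, of y] y by metis
    have "gdist adj x z = gdist adj z x" by (rule gdist_commute)
    then have "card (sphere_at adj d x \<inter> sphere_at adj (d - 1) z) =
        card (sphere_at adj d z \<inter> sphere_at adj (d - 1) x)"
      using regular unfolding distance_regular_def by blast
    moreover have "y \<in> sphere_at adj d x \<inter> sphere_at adj (d - 1) z"
      using y z by (simp add: sphere_at_def gdist_commute)
    ultimately have "sphere_at adj d z \<inter> sphere_at adj (d - 1) x \<noteq> {}"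
      by (metis card_eq_0_iff empty_iff finite)
    then obtain y' where y': "gdist adj z y' = d" "gdist adj x y' = d - 1"
      by (auto simp: sphere_at_def)
    have "set_dist C y' = d - 1"
      using gdist_clique[OF adj_clique z(1), of y'] set_dist_less[of y'] y'
      by (auto simp: gdist_commute)
    then have "y' \<in> minus (d - 1)" using y' by (simp add: minus_def)
    then show ?case by auto
  next
    case (Suc n)
    then obtain y where y: "set_dist C y = d - Suc n" "gdist adj x y = d - Suc n"
      by (auto simp: minus_def)
    have "gdist adj x y = Suc (d - Suc (Suc n))" using y Suc.prems by simp
    then obtain w where w: "gdist adj x w = d - Suc (Suc n)" "adj w y"
      by (rule gdist_step)
    have "set_dist C y \<le> Suc (set_dist C w)"
      using set_dist_adj_le[OF nonempty w(2)] .
    then have "w \<in> minus (d - Suc (Suc n))"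
      using gdist_base[of w] w y Suc.prems by (auto simp: minus_def)
    then show ?case by auto
  qed
  show ?thesis using *[of "d - Suc i"] assms by simp
qed

abbreviation W :: "(complex ^ 'a) set" where
  "W \<equiv> W_space adj d C x"

abbreviation MC :: "(complex ^ 'a) set" where
  "MC \<equiv> orbit_space (bose_mesner adj) (char_vec C)"

lemma W_space_eq: "W = range (\<lambda>F. \<chi> y. F (set_dist C y) (gdist adj x y))"
proof (intro equalityI subsetI)
  let ?R = "range (\<lambda>F. \<chi> y. F (set_dist C y) (gdist adj x y)) :: (complex ^ 'a) set"
  have "vec.subspace ?R"
    unfolding vec.subspace_def
  proof (intro conjI ballI allI)
    show "0 \<in> ?R"
      by (rule range_eqI[of _ _ "\<lambda>_ _. 0"]) (simp add: vec_eq_iff)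
  next
    fix u v assume "u \<in> ?R" "v \<in> ?R"
    then obtain F G where "u = (\<chi> y. F (set_dist C y) (gdist adj x y))"
      "v = (\<chi> y. G (set_dist C y) (gdist adj x y))" by blast
    then show "u + v \<in> ?R"
      by (intro range_eqI[of _ _ "\<lambda>i j. F i j + G i j"]) (simp add: vec_eq_iff)
  next
    fix c u assume "u \<in> ?R"
    then obtain F where "u = (\<chi> y. F (set_dist C y) (gdist adj x y))" by blast
    then show "c *s u \<in> ?R"
      by (intro range_eqI[of _ _ "\<lambda>i j. c * F i j"]) (simp add: vec_eq_iff)
  qed
  moreover have "char_vec (minus i) \<in> ?R" for i
    by (rule range_eqI[of _ _ "\<lambda>m j. if m = i \<and> j = i then 1 else 0"])
      (simp add: char_vec_def minus_def)
  moreover have "char_vec (plus i) \<in> ?R" for i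
    by (rule range_eqI[of _ _ "\<lambda>m j. if m = i \<and> j = Suc i then 1 else 0"])
      (simp add: char_vec_def plus_def)
  ultimately have "W \<subseteq> ?R"
    unfolding W_space_def minus_eq plus_eq by (intro vec.span_minimal) auto
  then show "u \<in> ?R" if "u \<in> W" for u using that by blast
next
  fix u :: "complex ^ 'a"
  assume "u \<in> range (\<lambda>F. \<chi> y. F (set_dist C y) (gdist adj x y))"
  then obtain F where u: "u = (\<chi> y. F (set_dist C y) (gdist adj x y))" by blast
  have "u = (\<Sum>i<d. F i i *s char_vec (minus i) + F i (Suc i) *s char_vec (plus i))"
  proof -
    have "u $ y = (\<Sum>i<d. F i i * (if y \<in> minus i then 1 else 0) +
        F i (Suc i) * (if y \<in> plus i then 1 else 0))" for y
    proof -
      have "(\<Sum>i<d. F i i * (if y \<in> minus i then 1 else 0) +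
        F i (Suc i) * (if y \<in> plus i then 1 else 0)) =
        (\<Sum>i<d. if i = set_dist C y then u $ y else 0)"
        using gdist_base[of y] by (intro sum.cong) (auto simp: minus_def plus_def u)
      then show ?thesis using set_dist_less[of y] by simp
    qed
    then show ?thesis by (simp add: vec_eq_iff char_vec_def)
  qed
  also have "\<dots> \<in> W"
    unfolding W_space_def minus_eq plus_eq
    by (intro vec.span_sum vec.span_add vec.span_scale vec.span_base) auto
  finally show "u \<in> W" .
qed

lemma subspace_W: "vec.subspace W"
  unfolding W_space_def by (rule vec.subspace_span)

text \<open>The sum of the cyclic modules of \<open>x\<close> and \<open>C\<close> under the Bose-Mesner algebra is \<open>W\<close>: it
  contains \<open>minus 0 = {x}\<close>, the sets \<open>minus i \<union> plus i\<close>, which are the layers of \<open>C\<close>, and the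
  sets \<open>plus i \<union> minus (i + 1)\<close>, which are the spheres around \<open>x\<close>.  This makes \<open>W\<close> invariant
  under the adjacency matrix.\<close>

lemma W_eq_sum_orbits:
  "W = {u + v |u v. u \<in> orbit_space (bose_mesner adj) (char_vec {x}) \<and> v \<in> MC}"
proof (intro equalityI subsetI)
  let ?S = "{u + v |u v. u \<in> orbit_space (bose_mesner adj) (char_vec {x}) \<and> v \<in> MC}"
  have sub: "vec.subspace ?S"
    by (intro vec.subspace_sums subspace_orbit_space)
  have left: "u \<in> ?S" if "u \<in> orbit_space (bose_mesner adj) (char_vec {x})" for u
    using that vec.subspace_0[OF subspace_orbit_space] by force
  have right: "u \<in> ?S" if "u \<in> MC" for u
    using that vec.subspace_0[OF subspace_orbit_space] by force
  have sphere: "char_vec {y. gdist adj x y = i} \<in> ?S" for i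
    by (rule left, unfold orbit_vertex_eq,
        rule range_eqI[of _ _ "\<lambda>j. if j = i then 1 else 0"]) (simp add: char_vec_def)
  have layer: "char_vec {y. set_dist C y = i} \<in> ?S" for i
    by (rule right, unfold orbit_clique_eq,
        rule range_eqI[of _ _ "\<lambda>j. if j = i then 1 else 0"]) (simp add: char_vec_def)
  have plus: "char_vec (plus i) \<in> ?S" if "char_vec (minus i) \<in> ?S" for i
  proof -
    have "char_vec (plus i) = (char_vec {y. set_dist C y = i} - char_vec (minus i) :: complex ^ 'a)"
      using gdist_base by (auto simp: vec_eq_iff char_vec_def minus_def plus_def)
    then show ?thesis using vec.subspace_diff[OF sub layer that] by simp
  qed
  have minus: "char_vec (minus i) \<in> ?S" for i
  proof (induction i)
    case 0
    have "minus 0 = {y. gdist adj x y = 0}"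
      using set_dist_eq_0_iff[OF nonempty] base by (auto simp: minus_def)
    then show ?case using sphere[of 0] by simp
  next
    case (Suc i)
    have "set_dist C y = i \<or> set_dist C y = Suc i" if "gdist adj x y = Suc i" for y
      using gdist_base[of y] that by auto
    then have "char_vec (minus (Suc i)) =
        (char_vec {y. gdist adj x y = Suc i} - char_vec (plus i) :: complex ^ 'a)"
      by (auto simp: vec_eq_iff char_vec_def minus_def plus_def)
    then show ?case using vec.subspace_diff[OF sub sphere plus[OF Suc.IH]] by simp
  qed
  have "W \<subseteq> ?S"
    unfolding W_space_def minus_eq plus_eq
    using sub minus plus by (intro vec.span_minimal) auto
  then show "w \<in> ?S" if "w \<in> W" for w using that by blast
next
  fix w assume "w \<in> {u + v |u v. u \<in> orbit_space (bose_mesner adj) (char_vec {x}) \<and> v \<in> MC}"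
  then obtain f g where "w = (\<chi> y. f (gdist adj x y)) + (\<chi> y. g (set_dist C y))"
    unfolding orbit_vertex_eq orbit_clique_eq by blast
  then show "w \<in> W"
    unfolding W_space_eq
    by (intro range_eqI[of _ _ "\<lambda>i j. f j + g i"]) (simp add: vec_eq_iff)
qed

lemma adj_mat_W:
  assumes "w \<in> W"
  shows "adj_mat adj *v w \<in> W"
proof -
  obtain u v where uv: "w = u + v" "u \<in> orbit_space (bose_mesner adj) (char_vec {x})" "v \<in> MC"
    using assms unfolding W_eq_sum_orbits by blast
  have "adj_mat adj *v w = adj_mat adj *v u + adj_mat adj *v v"
    unfolding uv(1) by (rule matrix_vector_right_distrib)
  then show ?thesis
    unfolding W_eq_sum_orbits
    using adj_mat_orbit_space[OF uv(2)] adj_mat_orbit_space[OF uv(3)] by blast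
qed

lemma diag_W:
  assumes "w \<in> W"
  shows "diag_mat (\<lambda>y. \<psi> (set_dist C y)) *v w \<in> W"
proof -
  obtain F where "w = (\<chi> y. F (set_dist C y) (gdist adj x y))"
    using assms unfolding W_space_eq by blast
  then show ?thesis
    unfolding W_space_eq
    by (intro range_eqI[of _ _ "\<lambda>i j. \<psi> i * F i j"]) (simp add: vec_eq_iff diag_mat_mult_vector)
qed

abbreviation U :: "(complex ^ 'a) set" where
  "U \<equiv> orth_compl_in W MC"

lemma herm_layer_constant:
  "herm w (\<chi> y. g (set_dist C y)) = (\<Sum>i<d. (\<Sum>y | set_dist C y = i. w $ y) * cnj (g i))"
proof -
  have "herm w (\<chi> y. g (set_dist C y)) =
      (\<Sum>i<d. \<Sum>y\<in>{y \<in> UNIV. set_dist C y = i}. w $ y * cnj (g (set_dist C y)))"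
    unfolding herm_def by (subst sum.group) (auto simp: set_dist_less)
  also have "\<dots> = (\<Sum>i<d. (\<Sum>y | set_dist C y = i. w $ y) * cnj (g i))"
    unfolding sum_distrib_right by (intro sum.cong) auto
  finally show ?thesis .
qed

lemma U_iff: "w \<in> U \<longleftrightarrow> w \<in> W \<and> (\<forall>i<d. (\<Sum>y | set_dist C y = i. w $ y) = 0)"
proof
  assume w: "w \<in> U"
  have "(\<Sum>y | set_dist C y = i. w $ y) = 0" if "i < d" for i
  proof -
    let ?g = "\<lambda>j. if j = i then 1 else 0 :: complex"
    have "(\<chi> y. ?g (set_dist C y)) \<in> MC"
      unfolding orbit_clique_eq by (rule range_eqI[where x = ?g]) simp
    then have "herm w (\<chi> y. ?g (set_dist C y)) = 0"
      using w unfolding orth_compl_in_def by blast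
    then show ?thesis
      unfolding herm_layer_constant[of w ?g] using that
      by (simp add: if_distrib[of cnj] if_distrib[of "(*) _"] cong: if_cong)
  qed
  then show "w \<in> W \<and> (\<forall>i<d. (\<Sum>y | set_dist C y = i. w $ y) = 0)"
    using w unfolding orth_compl_in_def by blast
next
  assume "w \<in> W \<and> (\<forall>i<d. (\<Sum>y | set_dist C y = i. w $ y) = 0)"
  then show "w \<in> U"
    unfolding orth_compl_in_def orbit_clique_eq by (auto simp: herm_layer_constant)
qed

text \<open>The vectors \<open>cellvec 0, \<dots>, cellvec (d - 1)\<close> form an orthogonal basis of \<open>U\<close>.  The two
  values of \<open>cellvec i\<close> on the layer \<open>i\<close> are chosen such that its sum over the layer is zero.\<close>

definition cellvec :: "nat \<Rightarrow> complex ^ 'a" where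
  "cellvec i = (\<chi> y. if y \<in> minus i then of_nat (card (plus i))
      else if y \<in> plus i then - of_nat (card (minus i)) else 0)"

text \<open>The projection to the vectors supported on the layer \<open>i\<close> of the clique.\<close>

definition layer_part :: "nat \<Rightarrow> complex ^ 'a \<Rightarrow> complex ^ 'a" where
  "layer_part i w = (\<chi> y. if set_dist C y = i then w $ y else 0)"

lemma sum_layer:
  "(\<Sum>y | set_dist C y = i. f y) = (\<Sum>y\<in>minus i. f y) + (\<Sum>y\<in>plus i. f y)"
proof -
  have "{y. set_dist C y = i} = minus i \<union> plus i"
    using gdist_base by (auto simp: minus_def plus_def)
  moreover have "minus i \<inter> plus i = {}" by (auto simp: minus_def plus_def)
  ultimately show ?thesis by (simp add: sum.union_disjoint)
qed

lemma not_minus_plus: "y \<in> minus i \<Longrightarrow> y \<notin> plus j"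
  by (auto simp: minus_def plus_def)

lemma cellvec_in_U: "cellvec i \<in> U"
  unfolding U_iff
proof (intro conjI allI impI)
  show "cellvec i \<in> W"
    unfolding W_space_eq
    by (rule range_eqI[of _ _ "\<lambda>m j. if m = i \<and> j = i then of_nat (card (plus i))
        else if m = i \<and> j = Suc i then - of_nat (card (minus i)) else 0"])
      (auto simp: cellvec_def vec_eq_iff minus_def plus_def)
next
  fix m assume "m < d"
  show "(\<Sum>y | set_dist C y = m. cellvec i $ y) = 0"
  proof (cases "m = i")
    case True
    have "(\<Sum>y\<in>minus i. cellvec i $ y) = (\<Sum>y\<in>minus i. of_nat (card (plus i)))"
      by (rule sum.cong) (auto simp: cellvec_def)
    moreover have "(\<Sum>y\<in>plus i. cellvec i $ y) = (\<Sum>y\<in>plus i. - of_nat (card (minus i)))"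
      by (rule sum.cong) (auto simp: cellvec_def not_minus_plus)
    ultimately show ?thesis
      unfolding True sum_layer by simp
  next
    case False
    then show ?thesis
      by (intro sum.neutral) (auto simp: cellvec_def minus_def plus_def)
  qed
qed

lemma card_cells_nonzero:
  "i < d \<Longrightarrow> card (minus i) \<noteq> 0" "i < d \<Longrightarrow> card (plus i) \<noteq> 0"
  using minus_nonempty plus_nonempty by auto

lemma layer_part_U:
  assumes w: "w \<in> U" and i: "i < d"
  obtains k where "layer_part i w = k *s cellvec i"
proof -
  have "w \<in> W" using w U_iff by blast
  then obtain F where F: "w = (\<chi> y. F (set_dist C y) (gdist adj x y))"
    unfolding W_space_eq by blast
  have "(\<Sum>y\<in>minus i. w $ y) = (\<Sum>y\<in>minus i. F i i)"
    by (rule sum.cong) (auto simp: F minus_def)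
  moreover have "(\<Sum>y\<in>plus i. w $ y) = (\<Sum>y\<in>plus i. F i (Suc i))"
    by (rule sum.cong) (auto simp: F plus_def)
  moreover have "(\<Sum>y\<in>minus i. w $ y) + (\<Sum>y\<in>plus i. w $ y) = 0"
    using w i by (simp add: U_iff sum_layer)
  ultimately have eq: "of_nat (card (minus i)) * F i i + of_nat (card (plus i)) * F i (Suc i) = 0"
    by (metis sum_constant)
  define k where "k = F i i / of_nat (card (plus i))"
  have Fm: "F i i = k * of_nat (card (plus i))"
    using card_cells_nonzero[OF i] by (simp add: k_def)
  have "of_nat (card (plus i)) * (F i (Suc i) + k * of_nat (card (minus i))) = 0"
    using eq unfolding Fm by (simp add: algebra_simps)
  then have Fp: "F i (Suc i) = - k * of_nat (card (minus i))"
    using card_cells_nonzero[OF i] by (simp add: add_eq_0_iff2)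
  have "layer_part i w $ y = (k *s cellvec i) $ y" for y
  proof -
    consider "set_dist C y \<noteq> i" | "y \<in> minus i" | "y \<in> plus i"
      using gdist_base[of y] by (auto simp: minus_def plus_def)
    then show ?thesis
    proof cases
      case 1
      then have "y \<notin> minus i" "y \<notin> plus i" by (auto simp: minus_def plus_def)
      then show ?thesis using 1 by (simp add: layer_part_def cellvec_def)
    next
      case 2
      then have "set_dist C y = i" "w $ y = F i i" by (auto simp: minus_def F)
      then show ?thesis using 2 Fm by (simp add: layer_part_def cellvec_def)
    next
      case 3
      then have "set_dist C y = i" "w $ y = F i (Suc i)" by (auto simp: plus_def F)
      then show ?thesis
        using 3 Fp not_minus_plus[of y i i] by (auto simp: layer_part_def cellvec_def)
    qed
  qed
  then have "layer_part i w = k *s cellvec i"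
    unfolding vec_eq_iff by blast
  then show thesis by (rule that)
qed

text \<open>If the eigenvalues \<open>\<psi> i\<close> of the diagonal matrix are distinct, then the projections to the
  layers are polynomials in it, by Lagrange interpolation, and so preserve its invariant
  subspaces.\<close>

lemma layer_part_in_module:
  assumes sub: "vec.subspace U'"
    and closed: "\<And>u. u \<in> U' \<Longrightarrow> diag_mat (\<lambda>y. \<psi> (set_dist C y)) *v u \<in> U'"
    and inj: "inj_on \<psi> {..<d}" and i: "i < d" and w: "w \<in> U'"
  shows "layer_part i w \<in> U'"
proof -
  have prod_in: "(\<chi> y. (\<Prod>j\<in>J. \<psi> (set_dist C y) - \<psi> j) * w $ y) \<in> U'" if "finite J" for J
    using that
  proof induction
    case empty
    then show ?case using w by simp
  next
    case (insert j J)
    let ?u = "\<chi> y. (\<Prod>j\<in>J. \<psi> (set_dist C y) - \<psi> j) * w $ y"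
    have "(\<chi> y. (\<Prod>j\<in>insert j J. \<psi> (set_dist C y) - \<psi> j) * w $ y) =
        diag_mat (\<lambda>y. \<psi> (set_dist C y)) *v ?u - \<psi> j *s ?u"
      using insert.hyps
      by (simp add: vec_eq_iff diag_mat_mult_vector left_diff_distrib mult.assoc)
    then show ?case
      using closed[OF insert.IH] sub insert.IH
      by (simp add: vec.subspace_diff vec.subspace_scale)
  qed
  let ?J = "{..<d} - {i}" and ?u = "\<chi> y. (\<Prod>j\<in>{..<d} - {i}. \<psi> (set_dist C y) - \<psi> j) * w $ y"
  define c where "c = (\<Prod>j\<in>?J. \<psi> i - \<psi> j)"
  have c: "c \<noteq> 0"
    using inj i unfolding c_def inj_on_def by auto
  have "(\<Prod>j\<in>?J. \<psi> (set_dist C y) - \<psi> j) = 0" if "set_dist C y \<noteq> i" for y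
    using that set_dist_less[of y] by (intro prod_zero) auto
  then have "layer_part i w = (1 / c) *s ?u"
    using c by (auto simp: layer_part_def vec_eq_iff c_def)
  then show ?thesis
    using prod_in[of ?J] sub by (simp add: vec.subspace_scale)
qed

text \<open>A vertex of \<open>plus (i + 1)\<close> has neighbours in the layer \<open>i\<close> of the clique, all of them in
  \<open>plus i\<close>, where \<open>cellvec i\<close> is constant and nonzero; so no cancellation occurs there.\<close>

lemma adj_cellvec_up:
  assumes "Suc i < d"
  shows "layer_part (Suc i) (adj_mat adj *v cellvec i) \<noteq> 0"
proof -
  obtain y where y: "set_dist C y = Suc i" "gdist adj x y = Suc (Suc i)"
    using plus_nonempty[OF assms] by (auto simp: plus_def)
  obtain w where w: "adj y w" "set_dist C w = i"
    using set_dist_step[OF nonempty y(1)] .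
  have nbr: "gdist adj x z \<ge> Suc i" if "adj y z" for z
    using gdist_adj_le[OF adj_sym[OF that], of x] y by simp
  have not_minus: "z \<notin> minus i" if "adj y z" for z
    using nbr[OF that] by (auto simp: minus_def)
  have "(adj_mat adj *v cellvec i) $ y =
      (\<Sum>z | adj y z. if z \<in> plus i then - of_nat (card (minus i)) else 0)"
    unfolding adj_mat_mult_vector using not_minus
    by (intro sum.cong) (auto simp: cellvec_def)
  also have "\<dots> = - of_nat (card ({z. adj y z} \<inter> plus i) * card (minus i))"
    by (simp add: sum.If_cases)
  finally have eq: "(adj_mat adj *v cellvec i) $ y =
      - of_nat (card ({z. adj y z} \<inter> plus i) * card (minus i))" .
  have "w \<in> {z. adj y z} \<inter> plus i"
    using w nbr[OF w(1)] gdist_base[of w] by (auto simp: plus_def)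
  then have "card ({z. adj y z} \<inter> plus i) \<noteq> 0" by auto
  then have "(adj_mat adj *v cellvec i) $ y \<noteq> 0"
    unfolding eq using card_cells_nonzero(1)[of i] assms by simp
  then have "layer_part (Suc i) (adj_mat adj *v cellvec i) $ y \<noteq> 0"
    using y by (simp add: layer_part_def)
  then show ?thesis by (metis zero_index)
qed

text \<open>Similarly, all the neighbours in the layer \<open>i + 1\<close> of a vertex of \<open>minus i\<close> are in
  \<open>minus (i + 1)\<close>, and some vertex of \<open>minus i\<close> has such a neighbour.\<close>

lemma adj_cellvec_down:
  assumes "Suc i < d"
  shows "layer_part i (adj_mat adj *v cellvec (Suc i)) \<noteq> 0"
proof -
  obtain w where w: "set_dist C w = Suc i" "gdist adj x w = Suc i"
    using minus_nonempty[OF assms] by (auto simp: minus_def)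
  obtain y where y: "gdist adj x y = i" "adj y w"
    using gdist_step[OF w(2)] .
  have yi: "set_dist C y = i"
    using set_dist_adj_le[OF nonempty y(2)] w y gdist_base[of y] by auto
  have nbr: "gdist adj x z \<le> Suc i" if "adj y z" for z
    using gdist_adj_le[OF that, of x] y by simp
  have not_plus: "z \<notin> plus (Suc i)" if "adj y z" for z
    using nbr[OF that] by (auto simp: plus_def)
  have "(adj_mat adj *v cellvec (Suc i)) $ y =
      (\<Sum>z | adj y z. if z \<in> minus (Suc i) then of_nat (card (plus (Suc i))) else 0)"
    unfolding adj_mat_mult_vector using not_plus
    by (intro sum.cong) (auto simp: cellvec_def)
  also have "\<dots> = of_nat (card ({z. adj y z} \<inter> minus (Suc i)) * card (plus (Suc i)))"
    by (simp add: sum.If_cases)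
  finally have eq: "(adj_mat adj *v cellvec (Suc i)) $ y =
      of_nat (card ({z. adj y z} \<inter> minus (Suc i)) * card (plus (Suc i)))" .
  have "w \<in> {z. adj y z} \<inter> minus (Suc i)"
    using w y by (auto simp: minus_def)
  then have "card ({z. adj y z} \<inter> minus (Suc i)) \<noteq> 0" by auto
  then have "(adj_mat adj *v cellvec (Suc i)) $ y \<noteq> 0"
    unfolding eq using card_cells_nonzero(2)[of "Suc i"] assms by simp
  then have "layer_part i (adj_mat adj *v cellvec (Suc i)) $ y \<noteq> 0"
    using yi by (simp add: layer_part_def)
  then show ?thesis by (metis zero_index)
qed

theorem irreducible_complement:
  assumes dual: "clique_dual_adj E1 C = diag_mat (\<lambda>y. \<psi> (set_dist C y))"
    and inj: "inj_on \<psi> {..<d}"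
  shows "irreducible_module (T_tilde adj E1 C) U"
  unfolding irreducible_module_def
proof (intro conjI allI impI)
  show "is_module (T_tilde adj E1 C) U"
    unfolding T_tilde_def
  proof (rule is_module_generated)
    show "vec.subspace U" using subspace_W by (rule subspace_orth_compl_in)
  next
    fix M u assume M: "M \<in> {adj_mat adj, clique_dual_adj E1 C}" and u: "u \<in> U"
    have "herm (adj_mat adj *v u) v = 0" if "v \<in> MC" for v
      unfolding herm_adj_mat using u adj_mat_orbit_space[OF that]
      unfolding orth_compl_in_def by blast
    then have "adj_mat adj *v u \<in> U"
      using u adj_mat_W[of u] unfolding orth_compl_in_def by blast
    moreover have "diag_mat (\<lambda>y. \<psi> (set_dist C y)) *v u \<in> U"
      unfolding U_iff
    proof (intro conjI allI impI)
      show "diag_mat (\<lambda>y. \<psi> (set_dist C y)) *v u \<in> W"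
        using u by (intro diag_W) (simp add: U_iff)
      fix i assume "i < d"
      have "(\<Sum>y | set_dist C y = i. (diag_mat (\<lambda>y. \<psi> (set_dist C y)) *v u) $ y) =
          \<psi> i * (\<Sum>y | set_dist C y = i. u $ y)"
        unfolding sum_distrib_left by (intro sum.cong) (auto simp: diag_mat_mult_vector)
      then show "(\<Sum>y | set_dist C y = i. (diag_mat (\<lambda>y. \<psi> (set_dist C y)) *v u) $ y) = 0"
        using u \<open>i < d\<close> unfolding U_iff by simp
    qed
    ultimately show "M *v u \<in> U" using M dual by auto
  qed
next
  obtain y where y: "y \<in> minus 0" using minus_nonempty[of 0] set_dist_less[of x] by auto
  then have "cellvec 0 $ y \<noteq> 0"
    using card_cells_nonzero(2)[of 0] set_dist_less[of x] by (auto simp: cellvec_def)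
  then have "cellvec 0 \<noteq> 0" by auto
  then show "U \<noteq> {0}" using cellvec_in_U[of 0] by blast
next
  fix U' assume "is_module (T_tilde adj E1 C) U' \<and> U' \<subseteq> U"
  then have sub: "vec.subspace U'" and U': "U' \<subseteq> U"
    and closed: "\<And>M u. M \<in> {adj_mat adj, clique_dual_adj E1 C} \<Longrightarrow> u \<in> U' \<Longrightarrow> M *v u \<in> U'"
    unfolding is_module_def T_tilde_def using generated_algebra.gen by blast+
  have adj_closed: "adj_mat adj *v u \<in> U'" if "u \<in> U'" for u
    using that closed by blast
  have part: "layer_part i u \<in> U'" if "i < d" "u \<in> U'" for i u
    using closed dual by (intro layer_part_in_module[OF sub _ inj that]) auto
  have cell: "cellvec i \<in> U'" if i: "i < d" and u: "u \<in> U'" and nz: "layer_part i u \<noteq> 0" for i u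
  proof -
    obtain k where k: "layer_part i u = k *s cellvec i"
      using layer_part_U[of u i] u U' i by blast
    then have "cellvec i = (1 / k) *s layer_part i u" using nz by auto
    then show ?thesis using part[OF i u] sub by (simp add: vec.subspace_scale)
  qed
  show "U' = {0} \<or> U' = U"
  proof (cases "U' = {0}")
    case False
    then obtain w where w: "w \<in> U'" "w \<noteq> 0"
      using vec.subspace_0[OF sub] by blast
    then obtain y where "w $ y \<noteq> 0" by (auto simp: vec_eq_iff)
    then have "layer_part (set_dist C y) w $ y \<noteq> 0" by (simp add: layer_part_def)
    then have "layer_part (set_dist C y) w \<noteq> 0" by auto
    then have start: "cellvec (set_dist C y) \<in> U'"
      using cell[OF set_dist_less w(1)] by blast
    have down: "cellvec i \<in> U'" if "Suc i < d" "cellvec (Suc i) \<in> U'" for i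
      using that by (intro cell[OF _ adj_closed[OF that(2)] adj_cellvec_down]) auto
    have up: "cellvec (Suc i) \<in> U'" if "Suc i < d" "cellvec i \<in> U'" for i
      using that by (intro cell[OF _ adj_closed[OF that(2)] adj_cellvec_up]) auto
    have zero: "cellvec 0 \<in> U'" if "i < d" "cellvec i \<in> U'" for i
      using that by (induction i) (auto intro: down)
    have all: "cellvec i \<in> U'" if "i < d" for i
      using that zero[OF set_dist_less start] by (induction i) (auto intro: up)
    have "u \<in> U'" if u: "u \<in> U" for u
    proof -
      have "layer_part i u \<in> U'" if "i < d" for i
        using layer_part_U[OF u that] all[OF that] sub by (metis vec.subspace_scale)
      then have "(\<Sum>i<d. layer_part i u) \<in> U'"
        using sub by (intro vec.subspace_sum) auto
      moreover have "(\<Sum>i<d. layer_part i u) = u"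
        by (simp add: vec_eq_iff layer_part_def set_dist_less)
      ultimately show ?thesis by simp
    qed
    then show ?thesis using U' by blast
  qed simp
qed

end


section \<open>Cosines from split sequences\<close>

text \<open>At a vertex where the diagonal matrix \<open>Bs\<close> has the eigenvalue \<open>\<theta>s i\<close>, its two-term action
  on the split vectors becomes a recursion for their values.\<close>

lemma split_vector_component:
  fixes u :: "nat \<Rightarrow> complex ^ 'a::finite"
  assumes act: "\<And>j. j \<le> n \<Longrightarrow> Bs *v u j = \<theta>s j *s u j + (if 0 < j then \<phi> j *s u (j - 1) else 0)"
    and diag: "\<And>v. (Bs *v v) $ y = \<theta>s i * v $ y"
    and "i \<le> j" "j \<le> n"
  shows "u j $ y * (\<Prod>m\<in>{i<..j}. \<theta>s i - \<theta>s m) = u i $ y * (\<Prod>m\<in>{i<..j}. \<phi> m)"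
  using \<open>i \<le> j\<close> \<open>j \<le> n\<close>
proof (induction j rule: dec_induct)
  case (step j)
  have ins: "{i<..Suc j} = insert (Suc j) {i<..j}" using step.hyps by auto
  have "\<theta>s i * u (Suc j) $ y = \<theta>s (Suc j) * u (Suc j) $ y + \<phi> (Suc j) * u j $ y"
    using act[OF step.prems] diag[of "u (Suc j)"] by simp
  then have *: "u (Suc j) $ y * (\<theta>s i - \<theta>s (Suc j)) = \<phi> (Suc j) * u j $ y"
    by (simp add: algebra_simps)
  have "u (Suc j) $ y * (\<Prod>m\<in>{i<..Suc j}. \<theta>s i - \<theta>s m) =
      (u (Suc j) $ y * (\<theta>s i - \<theta>s (Suc j))) * (\<Prod>m\<in>{i<..j}. \<theta>s i - \<theta>s m)"
    by (simp add: ins)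
  also have "\<dots> = \<phi> (Suc j) * (u j $ y * (\<Prod>m\<in>{i<..j}. \<theta>s i - \<theta>s m))"
    unfolding * by simp
  also have "\<dots> = u i $ y * (\<Prod>m\<in>{i<..Suc j}. \<phi> m)"
    using step by (simp add: ins)
  finally show ?case .
qed simp

context connected_graph
begin

lemma split_vector_support:
  assumes act: "\<And>j. j \<le> n \<Longrightarrow>
      adj_mat adj *v u j = \<theta> j *s u j + (if j < n then u (j + 1) else 0)"
    and base: "\<And>y. y \<noteq> x \<Longrightarrow> u 0 $ y = 0"
    and "j \<le> n" "gdist adj x y > j"
  shows "u j $ y = 0"
  using \<open>j \<le> n\<close> \<open>gdist adj x y > j\<close>
proof (induction j arbitrary: y)
  case 0
  then show ?case using base[of y] gdist_eq_0_iff[of x y] by fastforce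
next
  case (Suc j)
  have "u j $ z = 0" if "adj y z" for z
    using Suc gdist_adj_le[OF adj_sym[OF that], of x] by simp
  then have "(adj_mat adj *v u j) $ y = 0"
    by (simp add: adj_mat_mult_vector)
  moreover have "u j $ y = 0" using Suc by simp
  ultimately show ?case using act[of j] Suc.prems by simp
qed

text \<open>Consider two split bases for the same diagonal matrix \<open>Bs\<close>.  Their first vectors are
  supported at \<open>x\<close>.  The \<open>j\<close>-th vector of each basis is a monic polynomial of degree \<open>j\<close> in the
  adjacency matrix applied to the first one, so its values at distance \<open>j\<close> from \<open>x\<close> are the same
  for both, up to the scalar that relates the first vectors.  The action of \<open>Bs\<close> relates the last
  vectors to these values.\<close>

lemma split_bases_last_vectors:
  fixes u w :: "nat \<Rightarrow> complex ^ 'a"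
  assumes diag: "\<And>v y. (Bs *v v) $ y = \<theta>s (gdist adj x y) * v $ y"
    and inj: "inj_on \<theta>s {..n}"
    and dist: "\<And>y. gdist adj x y \<le> n"
    and uA: "\<And>j. j \<le> n \<Longrightarrow> adj_mat adj *v u j = \<theta> j *s u j + (if j < n then u (j + 1) else 0)"
    and uB: "\<And>j. j \<le> n \<Longrightarrow> Bs *v u j = \<theta>s j *s u j + (if 0 < j then \<phi> j *s u (j - 1) else 0)"
    and wA: "\<And>j. j \<le> n \<Longrightarrow> adj_mat adj *v w j = \<theta>' j *s w j + (if j < n then w (j + 1) else 0)"
    and wB: "\<And>j. j \<le> n \<Longrightarrow> Bs *v w j = \<theta>s j *s w j + (if 0 < j then \<phi>' j *s w (j - 1) else 0)"
  shows "\<And>y. y \<noteq> x \<Longrightarrow> u 0 $ y = 0" "\<And>y. y \<noteq> x \<Longrightarrow> w 0 $ y = 0"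
    "w 0 $ x * u n $ y * (\<Prod>m\<in>{gdist adj x y<..n}. \<phi>' m) =
     u 0 $ x * w n $ y * (\<Prod>m\<in>{gdist adj x y<..n}. \<phi> m)"
proof -
  have supp0: "v $ y = 0" if v: "Bs *v v = \<theta>s 0 *s v" and "y \<noteq> x" for v y
  proof -
    have "gdist adj x y \<noteq> 0" using \<open>y \<noteq> x\<close> by auto
    then have "\<theta>s (gdist adj x y) \<noteq> \<theta>s 0"
      using inj_onD[OF inj, of "gdist adj x y" 0] dist[of y] by force
    moreover have "\<theta>s (gdist adj x y) * v $ y = \<theta>s 0 * v $ y"
      using diag[of v y] unfolding v by auto
    ultimately show ?thesis by (metis mult_right_cancel)
  qed
  show u0: "u 0 $ y = 0" if "y \<noteq> x" for y
    using supp0[OF _ that] uB[of 0] by simp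
  show w0: "w 0 $ y = 0" if "y \<noteq> x" for y
    using supp0[OF _ that] wB[of 0] by simp
  \<comment> \<open>the leading parts cancel: \<open>z j\<close> vanishes at distance \<open>j\<close> or more from \<open>x\<close>\<close>
  define z where "z j = w 0 $ x *s u j - u 0 $ x *s w j" for j
  have z: "z j $ y = 0" if "j \<le> n" "gdist adj x y \<ge> j" for j y
    using that
  proof (induction j arbitrary: y)
    case 0
    then show ?case using u0[of y] w0[of y] by (cases "y = x") (auto simp: z_def)
  next
    case (Suc j)
    have "z j $ v = 0" if "adj y v" for v
      using Suc gdist_adj_le[OF adj_sym[OF that], of x] by simp
    then have "(adj_mat adj *v z j) $ y = 0"
      by (simp add: adj_mat_mult_vector)
    moreover have "adj_mat adj *v z j = w 0 $ x *s (adj_mat adj *v u j) - u 0 $ x *s (adj_mat adj *v w j)"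
      unfolding z_def
      by (simp add: matrix_vector_mult_diff_distrib vector_scalar_commute)
    moreover have "u j $ y = 0"
      using Suc.prems by (intro split_vector_support[OF uA u0]) auto
    moreover have "w j $ y = 0"
      using Suc.prems by (intro split_vector_support[OF wA w0]) auto
    ultimately show ?case
      using uA[of j] wA[of j] Suc.prems by (simp add: z_def)
  qed
  let ?i = "gdist adj x y"
  define T where "T = (\<Prod>m\<in>{?i<..n}. \<theta>s ?i - \<theta>s m)"
  have "\<theta>s ?i \<noteq> \<theta>s m" if "m \<in> {?i<..n}" for m
    using inj_onD[OF inj, of ?i m] that dist[of y] by force
  then have T: "T \<noteq> 0"
    unfolding T_def by simp
  have ud: "u n $ y * T = u ?i $ y * (\<Prod>m\<in>{?i<..n}. \<phi> m)"
    unfolding T_def using diag dist by (intro split_vector_component[OF uB]) auto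
  have wd: "w n $ y * T = w ?i $ y * (\<Prod>m\<in>{?i<..n}. \<phi>' m)"
    unfolding T_def using diag dist by (intro split_vector_component[OF wB]) auto
  have lead: "w 0 $ x * u ?i $ y = u 0 $ x * w ?i $ y"
    using z[OF dist, of y] by (simp add: z_def)
  have "(w 0 $ x * u n $ y * (\<Prod>m\<in>{?i<..n}. \<phi>' m)) * T =
      (w 0 $ x * u ?i $ y) * (\<Prod>m\<in>{?i<..n}. \<phi> m) * (\<Prod>m\<in>{?i<..n}. \<phi>' m)"
    using ud by (metis mult.assoc mult.commute)
  also have "\<dots> = (u 0 $ x * w n $ y * (\<Prod>m\<in>{?i<..n}. \<phi> m)) * T"
    unfolding lead using wd by (metis mult.assoc mult.commute)
  finally show "w 0 $ x * u n $ y * (\<Prod>m\<in>{?i<..n}. \<phi>' m) =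
      u 0 $ x * w n $ y * (\<Prod>m\<in>{?i<..n}. \<phi> m)"
    using T by simp
qed

end

lemma eigenvector_idempotent:
  fixes v :: "complex ^ 'a::finite" and n :: nat
  assumes orth: "\<And>i j. i \<le> n \<Longrightarrow> j \<le> n \<Longrightarrow> E i ** E j = (if i = j then E i else 0)"
    and sum: "(\<Sum>i\<le>n. E i) = mat 1"
    and B: "B = (\<Sum>i\<le>n. smat (\<theta> i) (E i))"
    and inj: "inj_on \<theta> {..n}" and i: "i \<le> n" and v: "B *v v = \<theta> i *s v"
  shows "E i *v v = v"
proof -
  have "E j *v v = 0" if j: "j \<le> n" "j \<noteq> i" for j
  proof -
    have "E j *v (B *v v) = (\<Sum>i\<le>n. \<theta> i *s ((E j ** E i) *v v))"
      unfolding B sum_vec_mult smat_mult_vector matrix_vector_mul_assoc[symmetric]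
      by (simp add: vec.linear_sum vector_scalar_commute)
    also have "\<dots> = (\<Sum>i\<le>n. if i = j then \<theta> j *s (E j *v v) else 0)"
      using orth j by (intro sum.cong) auto
    also have "\<dots> = \<theta> j *s (E j *v v)"
      using j(1) by (subst sum.delta) auto
    finally have "\<theta> i *s (E j *v v) = \<theta> j *s (E j *v v)"
      unfolding v by (simp add: vector_scalar_commute)
    moreover have "\<theta> i \<noteq> \<theta> j" using inj i j unfolding inj_on_def by auto
    ultimately show ?thesis by simp
  qed
  then have "(\<Sum>j\<le>n. E j *v v) = (\<Sum>j\<le>n. if j = i then E i *v v else 0)"
    by (intro sum.cong) auto
  then show ?thesis
    using i unfolding sum_vec_mult[symmetric] sum by simp
qed


section \<open>The dual eigenvalues of the clique in the q-Racah case\<close>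

text \<open>In the following lemma \<open>t\<close> stands for \<open>q ^ i\<close>, the split parameters \<open>p1\<close> and \<open>p2\<close> have
  index \<open>i + 1\<close> and the common factor \<open>g\<close>, and \<open>a\<close> and \<open>b\<close> are the dual eigenvalues with indices
  \<open>i\<close> and \<open>i + 1\<close>.  Both \<open>p1 - p2\<close> and \<open>b - a\<close> have the factor \<open>1 - ss q\<^sup>2 t\<^sup>2\<close>, which
  cancels.\<close>

lemma clique_dual_eigenvalue_formula:
  fixes q t ss g r1 r2 hs a0 :: complex
  assumes nz: "q \<noteq> 0" "t \<noteq> 0" "ss \<noteq> 0" "g \<noteq> 0" "ss \<noteq> r1 * r2" "ss * q\<^sup>2 * t\<^sup>2 \<noteq> 1"
    and p1: "p1 = g * (1 - r1 * (q * t)) * (1 - r2 * (q * t))"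
    and p2: "p2 = g * (r1 - ss * (q * t)) * (r2 - ss * (q * t)) / ss"
    and a: "a = a0 + hs * (1 - t) * (1 - ss * (q * t)) / t"
    and b: "b = a0 + hs * (1 - q * t) * (1 - ss * (q * (q * t))) / (q * t)"
  shows "(p1 * b - p2 * a) / (p1 - p2) =
    a0 - hs - hs * ss * q - hs * (1 - q) * ss * (r1 + r2) / (ss - r1 * r2) +
    hs * (ss - q * (r1 * r2)) / (q * (ss - r1 * r2)) * (1 / t + ss * q\<^sup>2 * t)"
proof -
  define k where "k = 1 - ss * q\<^sup>2 * t\<^sup>2"
  define m where "m = ss - r1 * r2"
  have k: "k \<noteq> 0" and m: "m \<noteq> 0" using nz by (auto simp: k_def m_def)
  have "ss * (p1 - p2) = g * m * k"
    using nz unfolding p1 p2 k_def m_def by (simp add: field_simps power2_eq_square)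
  then have diff: "p1 - p2 = g * m * k / ss" using nz by (simp add: field_simps)
  have "t * q * (b - a) = hs * (1 - q) * k"
    using nz unfolding a b k_def by (simp add: field_simps power2_eq_square)
  then have ba: "b - a = hs * (1 - q) * k / (q * t)" using nz by (simp add: field_simps)
  have ne: "p1 - p2 \<noteq> 0" unfolding diff using nz k m by simp
  have "p1 * b - p2 * a = a * (p1 - p2) + p1 * (b - a)" by (simp add: algebra_simps)
  then have "(p1 * b - p2 * a) / (p1 - p2) = a + p1 * (b - a) / (p1 - p2)"
    using ne by (simp add: add_divide_distrib)
  also have "p1 * (b - a) / (p1 - p2) =
      ss * (1 - r1 * (q * t)) * (1 - r2 * (q * t)) * hs * (1 - q) / (m * (q * t))"
    unfolding diff ba unfolding p1 using nz k m by (simp add: field_simps)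
  also have "a + \<dots> = a0 - hs - hs * ss * q - hs * (1 - q) * ss * (r1 + r2) / m +
    hs * (ss - q * (r1 * r2)) / (q * m) * (1 / t + ss * q\<^sup>2 * t)"
  proof -
    have r: "r1 * r2 = ss - m" by (simp add: m_def)
    have "(1 - r1 * (q * t)) * (1 - r2 * (q * t)) = 1 - (r1 + r2) * (q * t) + (r1 * r2) * (q * t)\<^sup>2"
      by (simp add: algebra_simps power2_eq_square)
    then have e: "ss * (1 - r1 * (q * t)) * (1 - r2 * (q * t)) =
        ss * (1 - (r1 + r2) * (q * t) + (ss - m) * (q * t)\<^sup>2)"
      using r by (metis mult.assoc)
    define R where "R = r1 + r2"
    show ?thesis
      unfolding a e r R_def[symmetric] using nz m
      by (simp add: field_simps power2_eq_square)
  qed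
  finally show ?thesis unfolding m_def .
qed

lemma q_Racah_clique_dual_inj:
  assumes qR: "q_Racah d q h hs s ss r1 r2 \<theta> \<theta>s \<phi>1 \<phi>2"
    and q: "q \<noteq> 0" and d: "d \<ge> 2"
    and \<phi>1: "\<And>i. i \<in> {1..d} \<Longrightarrow> \<phi>1 i \<noteq> 0"
  shows "inj_on (\<lambda>i. (\<phi>1 (Suc i) * \<theta>s (Suc i) - \<phi>2 (Suc i) * \<theta>s i) / (\<phi>1 (Suc i) - \<phi>2 (Suc i)))
    {..<d}"
proof -
  have nz: "hs \<noteq> 0" "ss \<noteq> 0" and r: "r1 * r2 = s * ss * q ^ (d + 1)"
    and q_ne: "\<And>i. i \<in> {1..d} \<Longrightarrow> q ^ i \<noteq> 1"
    and s_ne: "\<And>i. i \<in> {2..2 * d} \<Longrightarrow> s * q ^ i \<noteq> 1"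
    and ss_ne: "\<And>i. i \<in> {2..2 * d} \<Longrightarrow> ss * q ^ i \<noteq> 1"
    using qR unfolding q_Racah_def by auto
  \<comment> \<open>as \<open>r1 r2 = s ss q^(d + 1)\<close>, these say \<open>s q^(d + 1) \<noteq> 1\<close> and \<open>s q^(d + 2) \<noteq> 1\<close>\<close>
  have m: "ss \<noteq> r1 * r2" and m': "ss \<noteq> q * (r1 * r2)"
    using s_ne[of "d + 1"] s_ne[of "d + 2"] nz d unfolding r by (auto simp: mult_ac)
  define a where "a = \<theta>s 0 - hs - hs * ss * q - hs * (1 - q) * ss * (r1 + r2) / (ss - r1 * r2)"
  define b where "b = hs * (ss - q * (r1 * r2)) / (q * (ss - r1 * r2))"
  have b: "b \<noteq> 0" using nz m m' q by (simp add: b_def)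
  have formula: "(\<phi>1 (Suc i) * \<theta>s (Suc i) - \<phi>2 (Suc i) * \<theta>s i) / (\<phi>1 (Suc i) - \<phi>2 (Suc i)) =
      a + b * (1 / q ^ i + ss * q\<^sup>2 * q ^ i)" if i: "i < d" for i
  proof -
    define g where "g = h * hs * q powi (1 - 2 * int (Suc i)) * (1 - q ^ Suc i) *
         (1 - q powi (int (Suc i) - int d - 1))"
    have p1: "\<phi>1 (Suc i) = g * (1 - r1 * (q * q ^ i)) * (1 - r2 * (q * q ^ i))"
      using qR i unfolding q_Racah_def g_def by auto
    have p2: "\<phi>2 (Suc i) = g * (r1 - ss * (q * q ^ i)) * (r2 - ss * (q * q ^ i)) / ss"
      using qR i unfolding q_Racah_def g_def by auto
    have th: "\<theta>s j = \<theta>s 0 + hs * (1 - q ^ j) * (1 - ss * (q * q ^ j)) / q ^ j" if "j \<le> d" for j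
    proof -
      have "\<theta>s j = \<theta>s 0 + hs * (1 - q ^ j) * (1 - ss * q ^ (j + 1)) * q powi (- int j)"
        using qR that unfolding q_Racah_def by blast
      then show ?thesis by (simp add: power_int_minus divide_inverse)
    qed
    have "g \<noteq> 0" using p1 \<phi>1[of "Suc i"] i by auto
    moreover have "ss * q\<^sup>2 * (q ^ i)\<^sup>2 \<noteq> 1"
    proof -
      have "q\<^sup>2 * (q ^ i)\<^sup>2 = q ^ (2 * i + 2)"
        by (simp add: power_add power_mult[symmetric] mult.commute[of i] power2_eq_square[of q])
      then show ?thesis using ss_ne[of "2 * i + 2"] i by (simp add: mult.assoc)
    qed
    ultimately show ?thesis
      unfolding a_def b_def
      using q nz m i th[of i] th[of "Suc i"] p1 p2
      by (intro clique_dual_eigenvalue_formula[where g = g]) auto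
  qed
  show ?thesis
  proof (rule inj_onI)
    fix i j assume ij: "i \<in> {..<d}" "j \<in> {..<d}"
      and eq: "(\<phi>1 (Suc i) * \<theta>s (Suc i) - \<phi>2 (Suc i) * \<theta>s i) / (\<phi>1 (Suc i) - \<phi>2 (Suc i)) =
        (\<phi>1 (Suc j) * \<theta>s (Suc j) - \<phi>2 (Suc j) * \<theta>s j) / (\<phi>1 (Suc j) - \<phi>2 (Suc j))"
    have "1 / q ^ i + ss * q\<^sup>2 * q ^ i = 1 / q ^ j + ss * q\<^sup>2 * q ^ j"
      using eq ij b by (simp add: formula)
    moreover have "(q ^ j - q ^ i) * (1 - ss * q ^ (i + j + 2)) = q ^ i * q ^ j *
        ((1 / q ^ i + ss * q\<^sup>2 * q ^ i) - (1 / q ^ j + ss * q\<^sup>2 * q ^ j))"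
      using q by (simp add: field_simps power_add power2_eq_square)
    ultimately have "(q ^ j - q ^ i) * (1 - ss * q ^ (i + j + 2)) = 0" by simp
    moreover have "ss * q ^ (i + j + 2) \<noteq> 1"
      using ss_ne[of "i + j + 2"] ij by auto
    ultimately have pow: "q ^ i = q ^ j" by simp
    have no: "\<not> k < l" if "q ^ k = q ^ l" "l < d" for k l
    proof
      assume kl: "k < l"
      have "q ^ l = q ^ k * q ^ (l - k)" using kl by (simp add: power_add[symmetric])
      then have "q ^ (l - k) = 1" using that q by simp
      moreover have "l - k \<in> {1..d}" using kl that by auto
      ultimately show False using q_ne by blast
    qed
    show "i = j"
      using no[OF pow] no[OF pow[symmetric]] ij by auto
  qed
qed


section \<open>The idempotent of the least eigenvalue\<close>

lemma independent_nonzero: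
  fixes u :: "nat \<Rightarrow> complex ^ 'a::finite"
  assumes "vec.independent (u ` {..n})" "j \<le> n"
  shows "u j \<noteq> 0"
  using assms vec.dependent_zero by (metis atMost_iff imageI)

text \<open>A distance-regular graph of diameter \<open>d\<close>, with the primitive idempotents of its Bose-Mesner
  algebra ordered by decreasing eigenvalues.\<close>

locale drg_idempotents = drg +
  fixes d :: nat and E :: "nat \<Rightarrow> complex ^ 'a ^ 'a" and \<theta> :: "nat \<Rightarrow> real"
  assumes diameter: "diam adj = d" "d \<ge> 1"
    and idempotents: "primitive_idempotents (bose_mesner adj) d E"
    and E0: "E 0 = (\<chi> y z. 1 / of_nat CARD('a))"
    and eigenvalues: "adj_mat adj = (\<Sum>i\<le>d. smat (of_real (\<theta> i)) (E i))"
    and decreasing: "\<And>i j. i < j \<Longrightarrow> j \<le> d \<Longrightarrow> \<theta> j < \<theta> i"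
begin

lemma gdist_le_d: "gdist adj y z \<le> d"
  using gdist_le_diam diameter by metis

lemma E_mult: "i \<le> d \<Longrightarrow> j \<le> d \<Longrightarrow> E i ** E j = (if i = j then E i else 0)"
  using idempotents unfolding primitive_idempotents_def by blast

lemma E_sum: "(\<Sum>i\<le>d. E i) = mat 1"
  using idempotents unfolding primitive_idempotents_def by blast

lemma E_in_bose_mesner:
  assumes "i \<le> d"
  shows "E i \<in> bose_mesner adj"
proof -
  have "E i = (\<Sum>j\<le>d. smat (if j = i then 1 else 0) (E j))"
    using assms by (simp add: vec_eq_iff if_distrib[of "\<lambda>c. c * _"] cong: if_cong)
  then show ?thesis
    using idempotents unfolding primitive_idempotents_def by auto
qed

lemma inj_eigenvalues: "inj_on (\<lambda>i. complex_of_real (\<theta> i)) {..d}"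
proof (rule inj_onI)
  fix i j assume "i \<in> {..d}" "j \<in> {..d}" "complex_of_real (\<theta> i) = complex_of_real (\<theta> j)"
  then show "i = j"
    using decreasing[of i j] decreasing[of j i] by (cases i j rule: linorder_cases) auto
qed

lemma E_eigenvector:
  "i \<le> d \<Longrightarrow> adj_mat adj *v v = of_real (\<theta> i) *s v \<Longrightarrow> E i *v v = v"
  using eigenvector_idempotent[OF E_mult E_sum eigenvalues inj_eigenvalues] by blast

lemma adj_mat_E:
  assumes "i \<le> d"
  shows "adj_mat adj *v (E i *v v) = of_real (\<theta> i) *s (E i *v v)"
proof -
  have "adj_mat adj *v (E i *v v) = (\<Sum>j\<le>d. of_real (\<theta> j) *s ((E j ** E i) *v v))"
    unfolding eigenvalues sum_vec_mult smat_mult_vector matrix_vector_mul_assoc[symmetric] ..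
  also have "\<dots> = (\<Sum>j\<le>d. if j = i then of_real (\<theta> i) *s (E i *v v) else 0)"
    using E_mult assms by (intro sum.cong) auto
  also have "\<dots> = of_real (\<theta> i) *s (E i *v v)"
    using assms by (subst sum.delta) auto
  finally show ?thesis .
qed

lemma E_sym: "i \<le> d \<Longrightarrow> E i $ y $ z = E i $ z $ y"
  using bose_mesner_gdist[OF E_in_bose_mesner] gdist_commute by metis

text \<open>The entries of the idempotents are real: as the eigenvalues are real, the complex conjugate
  of \<open>E i\<close> is fixed by \<open>E i\<close>, which is symmetric.\<close>

lemma E_real:
  assumes i: "i \<le> d"
  shows "cnj (E i $ y $ z) = E i $ y $ z"
proof -
  have fixed: "(\<Sum>w\<in>UNIV. E i $ y $ w * cnj (E i $ w $ z)) = cnj (E i $ y $ z)" for y z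
  proof -
    define v where "v = (\<chi> w. E i $ w $ z)"
    define v' where "v' = (\<chi> w. cnj (v $ w))"
    have "v = E i *v char_vec {z}"
      by (simp add: vec_eq_iff v_def mat_vec_char_vec)
    then have "adj_mat adj *v v = of_real (\<theta> i) *s v"
      using adj_mat_E[OF i] by simp
    then have "(\<Sum>u | adj w u. v $ u) = of_real (\<theta> i) * v $ w" for w
      by (metis adj_mat_mult_vector vector_smult_component)
    then have "cnj (\<Sum>u | adj w u. v $ u) = cnj (of_real (\<theta> i) * v $ w)" for w
      by simp
    then have "adj_mat adj *v v' = of_real (\<theta> i) *s v'"
      by (simp add: vec_eq_iff adj_mat_mult_vector v'_def)
    then have "(E i *v v') $ y = v' $ y"
      using E_eigenvector[OF i] by simp
    then show ?thesis
      by (simp add: matrix_vector_mult_def v'_def v_def)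
  qed
  have "E i $ y $ z = cnj (cnj (E i $ y $ z))" by simp
  also have "\<dots> = (\<Sum>w\<in>UNIV. E i $ z $ w * cnj (E i $ w $ y))"
    unfolding fixed[of y z, symmetric]
    by (simp add: E_sym[OF i, of y] E_sym[OF i, of _ z] mult.commute)
  also have "\<dots> = cnj (E i $ y $ z)"
    unfolding fixed using E_sym[OF i, of y z] by simp
  finally show ?thesis by simp
qed

text \<open>The entries of the last idempotent \<open>E d\<close>, as a function of the distance, are determined by
  the two split sequences up to a factor: the last vectors of the two split bases are eigenvectors
  for \<open>\<theta> d\<close> and \<open>\<theta> 0\<close>, hence a multiple of a column of \<open>E d\<close> and a constant vector.\<close>

lemma last_idempotent_entries:
  assumes e: "\<And>y z. E d $ y $ z = e (gdist adj y z)"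
    and diag: "\<And>v y. (Bs *v v) $ y = \<theta>s (gdist adj x y) * v $ y"
    and inj: "inj_on \<theta>s {..d}"
    and split1: "split_sequence (orbit_space (bose_mesner adj) (char_vec {x})) d (adj_mat adj) Bs
      (\<lambda>i. of_real (\<theta> i)) \<theta>s \<phi>1"
    and split2: "split_sequence (orbit_space (bose_mesner adj) (char_vec {x})) d (adj_mat adj) Bs
      (\<lambda>i. of_real (\<theta> (d - i))) \<theta>s \<phi>2"
  obtains K where "K \<noteq> 0"
    "\<And>y. e (gdist adj x y) * (\<Prod>m\<in>{gdist adj x y<..d}. \<phi>2 m) =
         K * (\<Prod>m\<in>{gdist adj x y<..d}. \<phi>1 m)"
proof -
  let ?V = "orbit_space (bose_mesner adj) (char_vec {x})"
  obtain u where u: "vec.independent (u ` {..d})" "vec.span (u ` {..d}) = ?V"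
    "\<forall>j\<le>d. adj_mat adj *v u j = of_real (\<theta> j) *s u j + (if j < d then u (j + 1) else 0)"
    "\<forall>j\<le>d. Bs *v u j = \<theta>s j *s u j + (if 0 < j then \<phi>1 j *s u (j - 1) else 0)"
    using split1 unfolding split_sequence_def by (elim conjE exE) (rule that)
  obtain w where w: "vec.independent (w ` {..d})"
    "\<forall>j\<le>d. adj_mat adj *v w j = of_real (\<theta> (d - j)) *s w j + (if j < d then w (j + 1) else 0)"
    "\<forall>j\<le>d. Bs *v w j = \<theta>s j *s w j + (if 0 < j then \<phi>2 j *s w (j - 1) else 0)"
    using split2 unfolding split_sequence_def by (elim conjE exE) (rule that)
  note rel = split_bases_last_vectors[OF diag inj gdist_le_d u(3)[rule_format] u(4)[rule_format]
      w(2)[rule_format] w(3)[rule_format]]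
  have u0: "u 0 $ x \<noteq> 0"
  proof
    assume "u 0 $ x = 0"
    then have "u 0 $ y = 0" for y using rel(1)[of y] by (cases "y = x") auto
    then show False using independent_nonzero[OF u(1), of 0] by (simp add: vec_eq_iff)
  qed
  have w0: "w 0 $ x \<noteq> 0"
  proof
    assume "w 0 $ x = 0"
    then have "w 0 $ y = 0" for y using rel(2)[of y] by (cases "y = x") auto
    then show False using independent_nonzero[OF w(1), of 0] by (simp add: vec_eq_iff)
  qed
  have "u d \<in> ?V" using u(2) vec.span_superset[of "u ` {..d}"] by auto
  then obtain M where M: "M \<in> bose_mesner adj" "u d = M *v char_vec {x}"
    unfolding orbit_space_def by blast
  then obtain c where c: "M = (\<Sum>i\<le>d. smat (c i) (E i))"
    using idempotents unfolding primitive_idempotents_def by blast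
  have "u d = E d *v u d"
    using u(3)[rule_format, of d] by (intro E_eigenvector[symmetric]) auto
  also have "\<dots> = (\<Sum>i\<le>d. c i *s ((E d ** E i) *v char_vec {x}))"
    unfolding M(2) c sum_vec_mult smat_mult_vector matrix_vector_mul_assoc[symmetric]
    by (simp add: vec.linear_sum vector_scalar_commute)
  also have "\<dots> = (\<Sum>i\<le>d. if i = d then c d *s (E d *v char_vec {x}) else 0)"
    using E_mult by (intro sum.cong) auto
  also have "\<dots> = c d *s (E d *v char_vec {x})"
    by (subst sum.delta) auto
  finally have ud: "u d $ y = c d * e (gdist adj x y)" for y
    by (simp add: mat_vec_char_vec e gdist_commute)
  have cd: "c d \<noteq> 0"
  proof
    assume "c d = 0"
    then have "u d = 0" using ud by (simp add: vec_eq_iff)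
    then show False using independent_nonzero[OF u(1)] by simp
  qed
  define k where "k = (\<Sum>z\<in>UNIV. w d $ z) / of_nat CARD('a)"
  have "E 0 *v w d = w d"
    using w(2)[rule_format, of d] by (intro E_eigenvector) auto
  moreover have "(E 0 *v w d) $ y = k" for y
    by (simp add: k_def E0 matrix_vector_mult_def sum_divide_distrib)
  ultimately have wd: "w d $ y = k" for y by simp
  have k: "k \<noteq> 0"
  proof
    assume "k = 0"
    then have "w d = 0" using wd by (simp add: vec_eq_iff)
    then show False using independent_nonzero[OF w(1)] by simp
  qed
  show thesis
  proof (rule that)
    show "u 0 $ x * k / (w 0 $ x * c d) \<noteq> 0"
      using u0 w0 cd k by simp
    show "e (gdist adj x y) * (\<Prod>m\<in>{gdist adj x y<..d}. \<phi>2 m) =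
        u 0 $ x * k / (w 0 $ x * c d) * (\<Prod>m\<in>{gdist adj x y<..d}. \<phi>1 m)" for y
    proof -
      have "(w 0 $ x * c d) * (e (gdist adj x y) * (\<Prod>m\<in>{gdist adj x y<..d}. \<phi>2 m)) =
          (u 0 $ x * k) * (\<Prod>m\<in>{gdist adj x y<..d}. \<phi>1 m)"
        using rel(3)[of y] unfolding ud wd by (simp only: mult.assoc)
      then show ?thesis
        using cd w0 by (simp add: field_simps)
    qed
  qed
qed

lemma valency_eq: "valency adj = card {z. adj y z}"
proof -
  have deg: "sphere_at adj 1 y = {z. adj y z}" for y
    by (auto simp: sphere_at_def adj_iff_gdist)
  have reg: "card (sphere_at adj 1 v \<inter> sphere_at adj 1 w) = card {z. adj y z}"
    if "gdist adj v w = 0" for v w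
  proof -
    have "gdist adj v w = gdist adj y y" using that by simp
    then have "card (sphere_at adj 1 v \<inter> sphere_at adj 1 w) =
        card (sphere_at adj 1 y \<inter> sphere_at adj 1 y)"
      using regular unfolding distance_regular_def by blast
    then show ?thesis using deg by simp
  qed
  show ?thesis
    unfolding valency_def inter_num_def
  proof (rule the_equality)
    show "\<forall>v w. gdist adj v w = 0 \<longrightarrow>
        card (sphere_at adj 1 v \<inter> sphere_at adj 1 w) = card {z. adj y z}"
      using reg by blast
    fix n assume "\<forall>v w. gdist adj v w = 0 \<longrightarrow>
        card (sphere_at adj 1 v \<inter> sphere_at adj 1 w) = n"
    then show "n = card {z. adj y z}"
      using reg[of y y] by simp
  qed
qed

lemma ex_at_diameter: "\<exists>y. gdist adj x y = d"
proof -
  obtain v w where vw: "gdist adj v w = d"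
    using ex_gdist_diam diameter by metis
  have "gdist adj v v = gdist adj x x" by simp
  then have "card (sphere_at adj d v \<inter> sphere_at adj d v) =
      card (sphere_at adj d x \<inter> sphere_at adj d x)"
    using regular unfolding distance_regular_def by blast
  moreover have "w \<in> sphere_at adj d v" using vw by (simp add: sphere_at_def)
  ultimately have "sphere_at adj d x \<noteq> {}" by auto
  then show ?thesis by (auto simp: sphere_at_def)
qed

text \<open>The size of a Delsarte clique is such that \<open>E d\<close> annihilates its characteristic vector.\<close>

lemma delsarte_clique_annihilated:
  assumes C: "delsarte_clique adj (\<theta> d) C"
    and e: "\<And>y z. E d $ y $ z = e (gdist adj y z)"
    and e1: "e 1 \<noteq> 0"
  shows "(\<Sum>z\<in>C. e (gdist adj y z)) = 0"
proof -
  have adjC: "\<And>y z. y \<in> C \<Longrightarrow> z \<in> C \<Longrightarrow> y \<noteq> z \<Longrightarrow> adj y z"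
    and cardC: "real (card C) = 1 - real (valency adj) / \<theta> d"
    using C unfolding delsarte_clique_def by blast+
  obtain x0 :: 'a where True by blast
  have "(adj_mat adj *v (E d *v char_vec {x0})) $ x0 = of_nat (valency adj) * e 1"
  proof -
    have "(adj_mat adj *v (E d *v char_vec {x0})) $ x0 = (\<Sum>z | adj x0 z. e 1)"
      unfolding adj_mat_mult_vector mat_vec_char_vec e
      using adj_iff_gdist by (intro sum.cong) (auto simp: gdist_commute)
    then show ?thesis using valency_eq[of x0] by simp
  qed
  then have eig: "of_nat (valency adj) * e 1 = of_real (\<theta> d) * e 0"
    unfolding adj_mat_E[OF order.refl] by (simp add: mat_vec_char_vec e)
  have "valency adj \<noteq> 0"
  proof -
    obtain w where "gdist adj x0 w = d" using ex_at_diameter by blast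
    then obtain z where "gdist adj x0 z = 1"
      using ex_gdist_below[of x0 w d 1] diameter by auto
    then have "z \<in> {z. adj x0 z}" by (simp add: adj_iff_gdist)
    then show ?thesis unfolding valency_eq[of x0] by auto
  qed
  \<comment> \<open>this excludes the value \<open>card C = 1\<close> that division by zero would give\<close>
  then have \<theta>d: "\<theta> d \<noteq> 0" using eig e1 by auto
  then have "\<theta> d * (real (card C) - 1) = - real (valency adj)"
    unfolding cardC by (simp add: field_simps)
  then have "complex_of_real (\<theta> d * (real (card C) - 1)) = complex_of_real (- real (valency adj))"
    by (rule arg_cong)
  then have "of_real (\<theta> d) * (of_nat (card C) - 1) = - (of_nat (valency adj) :: complex)"
    by simp
  then have "of_real (\<theta> d) * (e 0 + (of_nat (card C) - 1) * e 1) = 0"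
    using eig by (simp add: distrib_left mult.assoc[symmetric])
  then have zero: "e 0 + (of_nat (card C) - 1) * e 1 = 0"
    using \<theta>d by simp
  define v where "v = E d *v char_vec C"
  have v: "v $ y = (\<Sum>z\<in>C. e (gdist adj y z))" for y
    by (simp add: v_def mat_vec_char_vec e)
  \<comment> \<open>\<open>v\<close> vanishes on \<open>C\<close>, so its squared norm, the sum of its values on \<open>C\<close>, is zero\<close>
  have v_C: "v $ y = 0" if y: "y \<in> C" for y
  proof -
    have "v $ y = e 0 + (\<Sum>z\<in>C - {y}. e (gdist adj y z))"
      unfolding v using y by (subst sum.remove[of _ y]) auto
    also have "(\<Sum>z\<in>C - {y}. e (gdist adj y z)) = (\<Sum>z\<in>C - {y}. e 1)"
      using adjC[OF y] adj_iff_gdist[of y] by (intro sum.cong) auto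
    also have "e 0 + \<dots> = e 0 + (of_nat (card C) - 1) * e 1"
      using card.remove[of C y] y by simp
    finally show ?thesis using zero by simp
  qed
  have v_real: "cnj (v $ y) = v $ y" for y
    unfolding v_def mat_vec_char_vec by (simp add: E_real)
  have fixed: "E d *v v = v"
    unfolding v_def using E_mult[of d d] by (simp add: matrix_vector_mul_assoc)
  have "(\<Sum>y\<in>UNIV. v $ y * v $ y) = (\<Sum>y\<in>UNIV. \<Sum>z\<in>C. E d $ y $ z * v $ y)"
    by (subst (1) v_def) (simp add: mat_vec_char_vec sum_distrib_right)
  also have "\<dots> = (\<Sum>z\<in>C. \<Sum>y\<in>UNIV. E d $ z $ y * v $ y)"
    by (subst sum.swap) (simp add: E_sym[of d])
  also have "\<dots> = (\<Sum>z\<in>C. (E d *v v) $ z)"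
    by (simp add: matrix_vector_mult_def)
  also have "\<dots> = 0" using fixed v_C by simp
  finally have "(\<Sum>y\<in>UNIV. v $ y * cnj (v $ y)) = 0"
    by (simp add: v_real)
  then have "complex_of_real (\<Sum>y\<in>UNIV. (cmod (v $ y))\<^sup>2) = 0"
    by (simp only: of_real_sum complex_norm_square)
  then have "(\<Sum>y\<in>UNIV. (cmod (v $ y))\<^sup>2) = 0"
    by (simp only: of_real_eq_0_iff)
  then have "v $ y = 0"
    by (subst (asm) sum_nonneg_eq_0_iff) auto
  then show ?thesis by (simp add: v)
qed

end

section \<open>Delsarte cliques in graphs of q-Racah type\<close>

theorem proposition7p4:
  fixes adj :: "'a::finite \<Rightarrow> 'a \<Rightarrow> bool"
    and d :: nat
    and E :: "nat \<Rightarrow> complex ^ 'a ^ 'a"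
    and \<theta> :: "nat \<Rightarrow> real"
    and \<theta>s \<phi>1 \<phi>2 :: "nat \<Rightarrow> complex"
    and C :: "'a set" and x :: 'a
    and q h hs s ss r1 r2 :: complex
  assumes graph: "connected_simple_graph adj"
    and diameter: "diam adj = d" "d \<ge> 3"
    and regular: "distance_regular adj"
    and idempotents: "primitive_idempotents (bose_mesner adj) d E"
    and E0: "E 0 = (\<chi> y z. 1 / of_nat CARD('a))"
    and eigenvalues: "adj_mat adj = (\<Sum>i\<le>d. smat (of_real (\<theta> i)) (E i))"
    and Q_poly: "Q_polynomial d E"
    and decreasing: "\<And>i j. i < j \<Longrightarrow> j \<le> d \<Longrightarrow> \<theta> j < \<theta> i"
    and clique: "delsarte_clique adj (\<theta> d) C"
    and base_vertex: "x \<in> C"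
    and dual_eigenvalues: "dual_adj (E 1) x = (\<Sum>i\<le>d. smat (\<theta>s i) (dual_idem adj x i))"
    and q: "q \<noteq> 0" "q\<^sup>2 \<noteq> 1"
    and param_array:
      "parameter_array (orbit_space (bose_mesner adj) (char_vec {x})) d
         (adj_mat adj) (dual_adj (E 1) x) E (dual_idem adj x)
         (\<lambda>i. of_real (\<theta> i)) \<theta>s \<phi>1 \<phi>2"
    and q_Racah: "q_Racah d q h hs s ss r1 r2 (\<lambda>i. of_real (\<theta> i)) \<theta>s \<phi>1 \<phi>2"
  shows "irreducible_module (T_tilde adj (E 1) C)
           (orth_compl_in (W_space adj d C x)
              (orbit_space (bose_mesner adj) (char_vec C)))"


proof -
  have "d \<ge> 1" and d2: "d \<ge> 2" using diameter(2) by simp_all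
  then interpret drg_idempotents adj d E \<theta>
    using graph diameter(1) regular idempotents E0 eigenvalues decreasing
    by unfold_locales
  let ?Bs = "dual_adj (E 1) x"
  have E1: "of_nat CARD('a) * E 1 $ x $ y = \<theta>s (gdist adj x y)" for y
  proof -
    have "of_nat CARD('a) * E 1 $ x $ y = dual_adj (E 1) x $ y $ y"
      by (simp add: dual_adj_def diag_mat_def)
    also have "\<dots> = (\<Sum>i\<le>d. if i = gdist adj x y then \<theta>s i else 0)"
      unfolding dual_eigenvalues
      by (simp add: dual_idem_def diag_mat_def if_distrib[of "(*) _"] eq_commute cong: if_cong)
    also have "\<dots> = \<theta>s (gdist adj x y)"
      using gdist_le_d by simp
    finally show ?thesis .
  qed
  have diag: "(?Bs *v v) $ y = \<theta>s (gdist adj x y) * v $ y" for v y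
    unfolding dual_adj_def diag_mat_mult_vector E1 ..
  have inj: "inj_on \<theta>s {..d}"
    using param_array
    unfolding parameter_array_def leonard_system_def spectral_idempotents_def by (elim conjE)
  have split1: "split_sequence (orbit_space (bose_mesner adj) (char_vec {x})) d (adj_mat adj) ?Bs
      (\<lambda>i. of_real (\<theta> i)) \<theta>s \<phi>1"
    using param_array unfolding parameter_array_def by (elim conjE)
  have split2: "split_sequence (orbit_space (bose_mesner adj) (char_vec {x})) d (adj_mat adj) ?Bs
      (\<lambda>i. of_real (\<theta> (d - i))) \<theta>s \<phi>2"
    using param_array unfolding parameter_array_def by (elim conjE)
  have \<phi>1: "\<phi>1 i \<noteq> 0" and \<phi>2: "\<phi>2 i \<noteq> 0" if "i \<in> {1..d}" for i
    using conjunct1[OF split1[unfolded split_sequence_def]]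
      conjunct1[OF split2[unfolded split_sequence_def]] that by blast+
  obtain e where e: "\<And>y z. E d $ y $ z = e (gdist adj y z)"
    using bose_mesner_gdist[OF E_in_bose_mesner[of d]] by blast
  obtain K where K: "K \<noteq> 0"
    "\<And>y. e (gdist adj x y) * (\<Prod>m\<in>{gdist adj x y<..d}. \<phi>2 m) =
         K * (\<Prod>m\<in>{gdist adj x y<..d}. \<phi>1 m)"
    using last_idempotent_entries[OF e diag inj split1 split2] by blast
  \<comment> \<open>dividing this for \<open>i\<close> by the same for \<open>i + 1\<close> gives the ratio \<open>e (i + 1) / e i\<close>\<close>
  have e_prod: "e i * (\<Prod>m\<in>{i<..d}. \<phi>2 m) = K * (\<Prod>m\<in>{i<..d}. \<phi>1 m)" if "i \<le> d" for i
    using K(2) ex_at_diameter[of x] ex_gdist_below[OF _ that] by metis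
  have e_nz: "e i \<noteq> 0" if "i \<le> d" for i
  proof
    assume "e i = 0"
    then have "(\<Prod>m\<in>{i<..d}. \<phi>1 m) = 0" using e_prod[OF that] K(1) by simp
    then show False using \<phi>1 by auto
  qed
  have e_Suc: "\<phi>1 (Suc i) * e (Suc i) = \<phi>2 (Suc i) * e i" if "i < d" for i
  proof -
    have ins: "{i<..d} = insert (Suc i) {Suc i<..d}" using that by auto
    let ?P1 = "\<Prod>m\<in>{Suc i<..d}. \<phi>1 m" and ?P2 = "\<Prod>m\<in>{Suc i<..d}. \<phi>2 m"
    have "?P2 \<noteq> 0" using \<phi>2 by auto
    moreover have "e i * (\<phi>2 (Suc i) * ?P2) = K * (\<phi>1 (Suc i) * ?P1)"
      using e_prod[of i] that by (simp add: ins)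
    moreover have "e (Suc i) * ?P2 = K * ?P1"
      using e_prod[of "Suc i"] that by simp
    ultimately have "(\<phi>1 (Suc i) * e (Suc i)) * ?P2 = (\<phi>2 (Suc i) * e i) * ?P2"
      by (metis mult.assoc mult.commute)
    then show ?thesis using \<open>?P2 \<noteq> 0\<close> by simp
  qed
  have adjC: "\<And>y z. y \<in> C \<Longrightarrow> z \<in> C \<Longrightarrow> y \<noteq> z \<Longrightarrow> adj y z"
    using clique unfolding delsarte_clique_def by blast
  have C: "C \<noteq> {}" "card C \<noteq> 0" using base_vertex by auto
  define N where "N y = complex_of_nat (card {z \<in> C. gdist adj y z = set_dist C y})" for y
  have e1: "e 1 \<noteq> 0" using e_nz[of 1] diameter by simp
  have balance: "N y * e (set_dist C y) + (of_nat (card C) - N y) * e (Suc (set_dist C y)) = 0" for y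
    unfolding N_def
    using delsarte_clique_annihilated[OF clique e e1, of y] sum_clique_gdist[OF adjC, of C e y]
    by simp
  \<comment> \<open>otherwise all of \<open>C\<close> is at distance \<open>d\<close> from \<open>y\<close>, contradicting \<open>e d \<noteq> 0\<close>\<close>
  have less: "set_dist C y < d" for y
  proof (rule ccontr)
    assume "\<not> set_dist C y < d"
    then have eq: "gdist adj y z = d" if "z \<in> C" for z
      using set_dist_le[OF that, of y] gdist_le_d[of y z] by simp
    then have "(\<Sum>z\<in>C. e (gdist adj y z)) = of_nat (card C) * e d" by simp
    then show False
      using delsarte_clique_annihilated[OF clique e e1, of y] e_nz[of d] C by simp
  qed
  let ?p1 = "\<lambda>i. \<phi>1 (Suc i)" and ?p2 = "\<lambda>i. \<phi>2 (Suc i)"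
  have N_eq: "N y * (?p1 (set_dist C y) - ?p2 (set_dist C y)) =
      - of_nat (card C) * ?p2 (set_dist C y)" for y
  proof -
    let ?i = "set_dist C y"
    let ?c = "of_nat (card C) - N y"
    have "(N y * ?p1 ?i + ?c * ?p2 ?i) * e ?i = N y * ?p1 ?i * e ?i + ?c * (?p2 ?i * e ?i)"
      by (simp only: distrib_right mult.assoc)
    also have "\<dots> = ?p1 ?i * (N y * e ?i + ?c * e (Suc ?i))"
      unfolding e_Suc[OF less[of y], symmetric] by (simp only: distrib_left mult_ac)
    finally have "N y * ?p1 ?i + ?c * ?p2 ?i = 0"
      using balance[of y] e_nz[of ?i] less[of y] by simp
    moreover have "N y * (?p1 ?i - ?p2 ?i) =
        (N y * ?p1 ?i + ?c * ?p2 ?i) - of_nat (card C) * ?p2 ?i"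
      by (simp add: left_diff_distrib right_diff_distrib)
    ultimately show ?thesis by simp
  qed
  have p_ne: "?p1 (set_dist C y) - ?p2 (set_dist C y) \<noteq> 0" for y
    using N_eq[of y] \<phi>2[of "Suc (set_dist C y)"] less[of y] C by auto
  have N_div: "N y = - of_nat (card C) * ?p2 (set_dist C y) /
      (?p1 (set_dist C y) - ?p2 (set_dist C y))" for y
    using N_eq[of y] p_ne[of y] by (metis nonzero_eq_divide_eq)
  interpret clique_partition adj C x d
  proof
    show "x \<in> C" by (rule base_vertex)
    show "adj y z" if "y \<in> C" "z \<in> C" "y \<noteq> z" for y z using adjC that .
    show "set_dist C y < d" for y by (rule less)
    show "\<exists>y. gdist adj x y = d" by (rule ex_at_diameter)
    fix y y' assume "set_dist C y = set_dist C y'"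
    then have "N y = N y'" unfolding N_div by simp
    then show "card {z \<in> C. gdist adj y z = set_dist C y} =
        card {z \<in> C. gdist adj y' z = set_dist C y'}"
      unfolding N_def by simp
  qed
  \<comment> \<open>the mean of \<open>\<theta>s i\<close> and \<open>\<theta>s (i + 1)\<close> with weights \<open>N y\<close> and \<open>|C| - N y\<close>\<close>
  let ?\<psi> = "\<lambda>i. (?p1 i * \<theta>s (Suc i) - ?p2 i * \<theta>s i) / (?p1 i - ?p2 i)"
  have d1: "1 \<le> d" using diameter by simp
  obtain f where f: "\<And>y z. E 1 $ y $ z = f (gdist adj y z)"
    using bose_mesner_gdist[OF E_in_bose_mesner[OF d1]] by blast
  have f_eq: "of_nat CARD('a) * f i = \<theta>s i" if i: "i \<le> d" for i
  proof -
    obtain w where "gdist adj x w = d" using ex_at_diameter by blast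
    then obtain y where y: "gdist adj x y = i" using ex_gdist_below i by blast
    show ?thesis using E1[of y] unfolding f y .
  qed
  have "clique_dual_adj (E 1) C = diag_mat (\<lambda>y. ?\<psi> (set_dist C y))"
  proof -
    have "(\<Sum>z\<in>C. of_nat CARD('a) * E 1 $ z $ y) / of_nat (card C) = ?\<psi> (set_dist C y)" for y
    proof -
      let ?i = "set_dist C y"
      have "(\<Sum>z\<in>C. of_nat CARD('a) * E 1 $ z $ y) = (\<Sum>z\<in>C. \<theta>s (gdist adj y z))"
      proof (rule sum.cong[OF refl])
        fix z
        show "of_nat CARD('a) * E 1 $ z $ y = \<theta>s (gdist adj y z)"
          unfolding f f_eq[OF gdist_le_d] gdist_commute[of z y] ..
      qed
      also have "\<dots> = N y * \<theta>s ?i + (of_nat (card C) - N y) * \<theta>s (Suc ?i)"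
        unfolding N_def by (rule sum_clique_gdist[OF adjC])
      also have "\<dots> = of_nat (card C) * ?\<psi> ?i"
      proof -
        let ?D = "?p1 ?i - ?p2 ?i"
        have "(N y * \<theta>s ?i + (of_nat (card C) - N y) * \<theta>s (Suc ?i)) * ?D =
            (N y * ?D) * \<theta>s ?i + (of_nat (card C) * ?D - N y * ?D) * \<theta>s (Suc ?i)"
          by (simp add: algebra_simps)
        also have "\<dots> = of_nat (card C) * (?p1 ?i * \<theta>s (Suc ?i) - ?p2 ?i * \<theta>s ?i)"
          unfolding N_eq by (simp add: algebra_simps)
        finally show ?thesis using p_ne[of y] by (simp add: eq_divide_eq)
      qed
      finally show ?thesis using C by simp
    qed
    then show ?thesis
      by (auto simp: clique_dual_adj_def dual_adj_def diag_mat_def vec_eq_iff)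
  qed
  moreover have "inj_on ?\<psi> {..<d}"
    using q_Racah q(1) d2 \<phi>1
    by (intro q_Racah_clique_dual_inj[where \<theta> = "\<lambda>i. of_real (\<theta> i)"]) auto
  ultimately show ?thesis by (rule irreducible_complement)
qed

end
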